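(* Let $r\ge 4$, $k\ge 2$ be integers, let $p\ge 1$ be a real number, and let $n>(r-1)k$ be an integer. Let $G$ be an $r$-graph of order $n$. If \[ \lambda^{(p)}(G)>r!\left(\binom nr-k\binom{n/k}{r}\right)n^{-r/p}, \] then $G$ is not $k$-chromatic. Equivalently, $\chi(G)\ge k+1$.
   Context: An $r$-graph is a pair $G=(V,E)$ with $V$ a finite set and $E$ a family of $r$-element subsets of $V$; its order is $|V|$. For $x\in\mathbb R^V$ put $P_G(x)=r!\sum_{e\in E}\prod_{v\in e}x_v$. For real $p\ge1$ the $p$-spectral radius of $G$ is $\lambda^{(p)}(G)=\max\{P_G(x): \sum_{v\in V}|x_v|^p=1\}$. An $r$-graph is called $k$-chromatic if its vertex set can be partitioned into $k$ (possibly empty) classes so that no edge is contained in a single class; $\chi(G)$ is the least $k$ such that $G$ is $k$-chromatic. For real $x$ and a nonnegative integer $s$, $\binom{x}{s}=\frac{x(x-1)\cdots(x-s+1)}{s!}$. *)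

theory Defs
  imports "HOL-Analysis.Analysis"
begin

definition r_graph :: "nat \<Rightarrow> 'a set \<Rightarrow> 'a set set \<Rightarrow> bool" where
  "r_graph r V E \<longleftrightarrow> finite V \<and> (\<forall>e\<in>E. e \<subseteq> V \<and> card e = r)"

text \<open>A vector in \<open>\<real>\<^sup>V\<close> is represented by a function on the whole vertex type. Only its values
  on \<open>V\<close> matter, both for the polynomial form of a hypergraph on \<open>V\<close> and for the constraint
  defining the spectral radius.\<close>

definition poly_form :: "nat \<Rightarrow> 'a set set \<Rightarrow> ('a \<Rightarrow> real) \<Rightarrow> real" where
  "poly_form r E x = fact r * (\<Sum>e\<in>E. \<Prod>v\<in>e. x v)"

definition p_sphere :: "real \<Rightarrow> 'a set \<Rightarrow> ('a \<Rightarrow> real) set" where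
  "p_sphere p V = {x. (\<Sum>v\<in>V. \<bar>x v\<bar> powr p) = 1}"

text \<open>The maximum is written as a supremum; the lemma \<open>spectral_radius_is_max\<close> below shows that it
  is attained whenever \<open>V\<close> is nonempty and \<open>p \<ge> 1\<close>.\<close>

definition spectral_radius :: "real \<Rightarrow> nat \<Rightarrow> 'a set \<Rightarrow> 'a set set \<Rightarrow> real" where
  "spectral_radius p r V E = (SUP x\<in>p_sphere p V. poly_form r E x)"

definition k_chromatic :: "nat \<Rightarrow> 'a set \<Rightarrow> 'a set set \<Rightarrow> bool" where
  "k_chromatic k V E \<longleftrightarrow>
    (\<exists>W :: nat \<Rightarrow> 'a set. (\<Union>i<k. W i) = V \<and> disjoint_family_on W {..<k} \<and>
      (\<forall>e\<in>E. \<forall>i<k. \<not> e \<subseteq> W i))"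

definition chromatic_number :: "'a set \<Rightarrow> 'a set set \<Rightarrow> nat" where
  "chromatic_number V E = (LEAST k. k_chromatic k V E)"

lemma spectral_radius_is_max:
  fixes p :: real
  assumes G: "r_graph r V E" and "V \<noteq> {}" and p: "p \<ge> 1"
  shows "\<exists>x\<in>p_sphere p V. poly_form r E x = spectral_radius p r V E \<and>
           (\<forall>y\<in>p_sphere p V. poly_form r E y \<le> poly_form r E x)"
proof -
  have fin: "finite V" and EV: "\<And>e. e \<in> E \<Longrightarrow> e \<subseteq> V"
    using G by (auto simp: r_graph_def)
  define S where "S = (\<lambda>v. if v \<in> V then {-1..1::real} else {0})"
  define B where "B = PiE UNIV S"
  define K where "K = B \<inter> p_sphere p V"
  have "compactin (product_topology (\<lambda>_. euclidean) UNIV) (PiE UNIV S)"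
    by (subst compactin_PiE) (auto simp: S_def)
  then have cB: "compact B"
    by (simp add: B_def euclidean_product_topology)
  have cont: "continuous_on UNIV (\<lambda>x::'a \<Rightarrow> real. x v)" for v
    by (rule continuous_on_product_coordinates)
  have cs: "continuous_on UNIV (\<lambda>x::'a \<Rightarrow> real. \<Sum>v\<in>V. \<bar>x v\<bar> powr p)"
    by (intro continuous_on_sum continuous_on_powr' continuous_on_rabs cont continuous_on_const)
       (use p in auto)
  have "closed (p_sphere p V)"
    unfolding p_sphere_def
    by (intro closed_Collect_eq cs continuous_on_const)
  then have cK: "compact K"
    using compact_Int_closed[OF cB] unfolding K_def by simp
  have cP: "continuous_on K (poly_form r E)"
    unfolding poly_form_def
    by (intro continuous_on_mult continuous_on_const continuous_on_sum continuous_on_prod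
        continuous_on_subset[OF cont subset_UNIV])
  obtain v0 where v0: "v0 \<in> V" using \<open>V \<noteq> {}\<close> by auto
  have "(\<lambda>v. if v = v0 then 1 else 0) \<in> K"
    using v0 fin by (auto simp: K_def B_def S_def p_sphere_def if_distrib if_distribR sum.delta
        cong: if_cong)
  then obtain x where x: "x \<in> K" and mx: "\<And>y. y \<in> K \<Longrightarrow> poly_form r E y \<le> poly_form r E x"
    using continuous_attains_sup[OF cK _ cP] by blast
  have le: "poly_form r E y \<le> poly_form r E x" if y: "y \<in> p_sphere p V" for y
  proof -
    define z where "z = (\<lambda>v. if v \<in> V then y v else 0)"
    have "poly_form r E y = poly_form r E z"
      unfolding poly_form_def z_def
      using EV by (intro arg_cong[where f = "(*) (fact r)"] sum.cong prod.cong) auto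
    moreover have "z \<in> K"
    proof -
      have sy: "(\<Sum>v\<in>V. \<bar>y v\<bar> powr p) = 1" using y by (simp add: p_sphere_def)
      have "\<bar>y v\<bar> \<le> 1" if "v \<in> V" for v
      proof (rule ccontr)
        assume "\<not> \<bar>y v\<bar> \<le> 1"
        then have "1 < \<bar>y v\<bar> powr p" using p by (intro gr_one_powr) auto
        also have "\<dots> \<le> (\<Sum>v\<in>V. \<bar>y v\<bar> powr p)"
          using that fin by (intro member_le_sum) auto
        finally show False using sy by simp
      qed
      then have "z \<in> B" by (fastforce simp: B_def S_def z_def abs_le_iff)
      moreover have "z \<in> p_sphere p V" using sy by (simp add: p_sphere_def z_def)
      ultimately show ?thesis by (simp add: K_def)
    qed
    ultimately show ?thesis using mx by simp
  qed
  have xs: "x \<in> p_sphere p V" using x by (simp add: K_def)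
  have "spectral_radius p r V E = poly_form r E x"
    unfolding spectral_radius_def using xs le by (intro cSup_eq_maximum) auto
  then show ?thesis using xs le by auto
qed

end

theory Submission
  imports Defs
begin

text \<open>By the power mean inequality only \<open>p = 1\<close> matters: with weights \<open>x \<ge> 0\<close> of total mass \<open>n\<close>
  one has to bound \<open>F x = e\<^sub>r(V) - \<Sum>\<^sub>i e\<^sub>r(V\<^sub>i)\<close>, where \<open>V\<^sub>i\<close> are the colour classes and \<open>e\<^sub>r\<close> is the
  elementary symmetric polynomial. At a maximizer with \<open>F x > 0\<close> the weights are positive and
  constant, say \<open>a\<^sub>i\<close>, on each class, and all partial derivatives agree. Averaging them over the
  vertices and applying Maclaurin's inequality to \<open>e\<^sub>r\<^sub>-\<^sub>1(V)\<close> only, the claim becomes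
  \<open>\<Sum>\<^sub>i N\<^sub>i B\<^sub>i \<ge> r k (n/k gchoose r)\<close> for \<open>N\<^sub>i = |V\<^sub>i|\<close> and \<open>B\<^sub>i = (N\<^sub>i - 1 choose r - 1) a\<^sub>i\<^sup>r\<^sup>-\<^sup>1\<close>.
  Stationarity gives \<open>(a\<^sub>i - a\<^sub>j) e\<^sub>r\<^sub>-\<^sub>2(V - u - v) = B\<^sub>j - B\<^sub>i\<close>. If the claimed bound failed, then
  \<open>e\<^sub>r\<^sub>-\<^sub>2(V - u - v)\<close> would be large, so heavier weights would sit on classes that are smaller both in
  size and in mass by a quantifiable margin, and Chebyshev's sum inequality together with a
  tangent line bound would yield the required inequality.\<close>

section \<open>Elementary symmetric polynomials\<close>

definition esym :: "nat \<Rightarrow> 'a set \<Rightarrow> ('a \<Rightarrow> real) \<Rightarrow> real" where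
  "esym s A x = (\<Sum>S | S \<subseteq> A \<and> card S = s. \<Prod>v\<in>S. x v)"

lemma esym_cong: "(\<And>v. v \<in> A \<Longrightarrow> x v = y v) \<Longrightarrow> esym s A x = esym s A y"
  unfolding esym_def by (intro sum.cong prod.cong) auto

lemma esym_0: "finite A \<Longrightarrow> esym 0 A x = 1"
proof -
  assume "finite A"
  then have "{S. S \<subseteq> A \<and> card S = 0} = {{}}" by (auto dest: finite_subset)
  then show ?thesis by (simp add: esym_def)
qed

lemma esym_nonneg: "(\<And>v. v \<in> A \<Longrightarrow> 0 \<le> x v) \<Longrightarrow> 0 \<le> esym s A x"
  unfolding esym_def by (intro sum_nonneg prod_nonneg) auto

lemma esym_const:
  assumes "finite A" "\<And>v. v \<in> A \<Longrightarrow> x v = a"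
  shows "esym s A x = real (card A choose s) * a ^ s"
proof -
  have "esym s A x = (\<Sum>S | S \<subseteq> A \<and> card S = s. a ^ s)"
    unfolding esym_def
  proof (intro sum.cong refl)
    fix S assume S: "S \<in> {S. S \<subseteq> A \<and> card S = s}"
    then have "(\<Prod>v\<in>S. x v) = (\<Prod>v\<in>S. a)" using assms(2) by (intro prod.cong) auto
    then show "(\<Prod>v\<in>S. x v) = a ^ s" using S by simp
  qed
  then show ?thesis using n_subsets[OF assms(1)] by simp
qed

text \<open>Subsets are sorted by whether they contain \<open>v\<close>. The polynomial is affine in
  each variable, so \<open>esym s (A - {v}) x\<close> is its partial derivative at \<open>v\<close>
  and serves as such throughout.\<close>

lemma esym_remove:
  assumes fin: "finite A" and v: "v \<in> A"
  shows "esym (Suc s) A x = esym (Suc s) (A - {v}) x + x v * esym s (A - {v}) x"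
proof -
  let ?P = "{S. S \<subseteq> A - {v} \<and> card S = Suc s}"
  let ?Q = "{S. S \<subseteq> A - {v} \<and> card S = s}"
  have fS: "S \<subseteq> A - {v} \<Longrightarrow> finite S" for S using fin finite_subset by blast
  have un: "{S. S \<subseteq> A \<and> card S = Suc s} = ?P \<union> insert v ` ?Q"
  proof (intro set_eqI iffI)
    fix S assume S: "S \<in> {S. S \<subseteq> A \<and> card S = Suc s}"
    show "S \<in> ?P \<union> insert v ` ?Q"
    proof (cases "v \<in> S")
      case True
      then have "S = insert v (S - {v})" by auto
      moreover have "S - {v} \<in> ?Q" using S True fin by (auto simp: card_Diff_singleton)
      ultimately show ?thesis by blast
    qed (use S in auto)
  next
    fix S assume "S \<in> ?P \<union> insert v ` ?Q"
    then show "S \<in> {S. S \<subseteq> A \<and> card S = Suc s}"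
    proof
      assume "S \<in> insert v ` ?Q"
      then obtain T where "T \<in> ?Q" "S = insert v T" by auto
      moreover have "finite T" "v \<notin> T" using \<open>T \<in> ?Q\<close> fS by auto
      ultimately show ?thesis using v by auto
    qed auto
  qed
  have inj: "inj_on (insert v) ?Q" by (rule inj_onI) (auto simp: insert_eq_iff)
  have "esym (Suc s) A x = (\<Sum>S\<in>?P. \<Prod>v\<in>S. x v) + (\<Sum>S\<in>insert v ` ?Q. \<Prod>v\<in>S. x v)"
    unfolding esym_def un using fin
    by (intro sum.union_disjoint) (auto intro!: finite_imageI)
  also have "(\<Sum>S\<in>insert v ` ?Q. \<Prod>v\<in>S. x v) = (\<Sum>S\<in>?Q. \<Prod>v\<in>insert v S. x v)"
    using inj by (simp add: sum.reindex)
  also have "\<dots> = (\<Sum>S\<in>?Q. x v * (\<Prod>v\<in>S. x v))"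
    using fS by (intro sum.cong refl prod.insert) auto
  finally show ?thesis by (simp add: esym_def sum_distrib_left)
qed

lemma esym_remove2:
  assumes "finite A" "u \<in> A" "v \<in> A" "u \<noteq> v"
  shows "esym (Suc (Suc s)) A x =
    esym (Suc (Suc s)) (A - {u, v}) x + (x u + x v) * esym (Suc s) (A - {u, v}) x
      + x u * x v * esym s (A - {u, v}) x"
proof -
  have A: "A - {u} - {v} = A - {u, v}" by auto
  show ?thesis
    using esym_remove[of A u "Suc s" x] esym_remove[of "A - {u}" v "Suc s" x]
      esym_remove[of "A - {u}" v s x] assms
    by (simp add: A algebra_simps)
qed

text \<open>In the difference of two partial derivatives the terms avoiding both \<open>u\<close>
  and \<open>v\<close> cancel. For nonnegative weights, a heavier vertex thus has a partial
  derivative that is no larger.\<close>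

lemma esym_remove_diff:
  assumes "finite A" "u \<in> A" "v \<in> A" "u \<noteq> v"
  shows "esym (Suc s) (A - {u}) x - esym (Suc s) (A - {v}) x = (x v - x u) * esym s (A - {u, v}) x"
proof -
  have A: "A - {u} - {v} = A - {u, v}" "A - {v} - {u} = A - {u, v}" by auto
  show ?thesis
    using esym_remove[of "A - {u}" v s x] esym_remove[of "A - {v}" u s x] assms
    by (simp add: A algebra_simps)
qed

text \<open>Double counting: an \<open>s\<close>-subset of \<open>A\<close> is missed by exactly
  \<open>card A - s\<close> elements of \<open>A\<close>.\<close>

lemma sum_esym_remove:
  assumes fin: "finite A"
  shows "(\<Sum>v\<in>A. esym s (A - {v}) x) = (real (card A) - real s) * esym s A x"
proof -
  have "(\<Sum>v\<in>A. esym s (A - {v}) x) = (\<Sum>v\<in>A. \<Sum>S | S \<in> {S. S \<subseteq> A \<and> card S = s} \<and> v \<notin> S. \<Prod>w\<in>S. x w)"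
    unfolding esym_def by (intro sum.cong) auto
  also have "\<dots> = (\<Sum>S\<in>{S. S \<subseteq> A \<and> card S = s}. \<Sum>v | v \<in> A \<and> v \<notin> S. \<Prod>w\<in>S. x w)"
    using fin by (intro sum.swap_restrict) auto
  also have "\<dots> = (\<Sum>S\<in>{S. S \<subseteq> A \<and> card S = s}. (real (card A) - real s) * (\<Prod>w\<in>S. x w))"
  proof (intro sum.cong refl)
    fix S assume S: "S \<in> {S. S \<subseteq> A \<and> card S = s}"
    have "{v. v \<in> A \<and> v \<notin> S} = A - S" by auto
    moreover have "card (A - S) = card A - s" "s \<le> card A"
      using S fin by (auto simp: card_Diff_subset finite_subset intro: card_mono)
    ultimately show "(\<Sum>v | v \<in> A \<and> v \<notin> S. \<Prod>w\<in>S. x w) = (real (card A) - real s) * (\<Prod>w\<in>S. x w)"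
      by (simp add: of_nat_diff)
  qed
  finally show ?thesis by (simp add: esym_def sum_distrib_left)
qed

text \<open>Euler's identity for a homogeneous polynomial of degree \<open>Suc s\<close>, obtained
  by summing \<open>esym_remove\<close> over all \<open>v\<close>.\<close>

lemma sum_mult_esym_remove:
  assumes fin: "finite A"
  shows "(\<Sum>v\<in>A. x v * esym s (A - {v}) x) = real (Suc s) * esym (Suc s) A x"
proof -
  have "(\<Sum>v\<in>A. esym (Suc s) A x) = (\<Sum>v\<in>A. esym (Suc s) (A - {v}) x + x v * esym s (A - {v}) x)"
    by (intro sum.cong refl esym_remove fin)
  then show ?thesis
    using sum_esym_remove[OF fin, of "Suc s" x] by (simp add: sum.distrib algebra_simps)
qed

section \<open>Chebyshev's sum inequality and Maclaurin's inequality\<close>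

lemma Chebyshev_identity:
  fixes f g :: "'i \<Rightarrow> real"
  shows "(\<Sum>i\<in>I. \<Sum>j\<in>I. (f i - f j) * (g i - g j)) =
    2 * (real (card I) * (\<Sum>i\<in>I. f i * g i) - sum f I * sum g I)"
proof -
  have "(\<Sum>i\<in>I. \<Sum>j\<in>I. (f i - f j) * (g i - g j)) =
      (\<Sum>i\<in>I. \<Sum>j\<in>I. f i * g i) + (\<Sum>i\<in>I. \<Sum>j\<in>I. f j * g j)
        - (\<Sum>i\<in>I. \<Sum>j\<in>I. f i * g j) - (\<Sum>i\<in>I. \<Sum>j\<in>I. f j * g i)"
    by (simp add: sum.distrib sum_subtractf algebra_simps)
  moreover have "(\<Sum>i\<in>I. \<Sum>j\<in>I. f i * g j) = sum f I * sum g I"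
    by (simp add: sum_product)
  moreover have "(\<Sum>i\<in>I. \<Sum>j\<in>I. f j * g i) = sum f I * sum g I"
    by (subst sum.swap) (simp add: sum_product)
  ultimately show ?thesis by (simp flip: sum_distrib_left)
qed

lemma Chebyshev_same:
  fixes f g :: "'i \<Rightarrow> real"
  assumes "\<And>i j. i \<in> I \<Longrightarrow> j \<in> I \<Longrightarrow> 0 \<le> (f i - f j) * (g i - g j)"
  shows "sum f I * sum g I \<le> real (card I) * (\<Sum>i\<in>I. f i * g i)"
proof -
  have "0 \<le> (\<Sum>i\<in>I. \<Sum>j\<in>I. (f i - f j) * (g i - g j))"
    using assms by (intro sum_nonneg) auto
  then show ?thesis by (simp add: Chebyshev_identity)
qed

lemma Chebyshev_opposite:
  fixes f g :: "'i \<Rightarrow> real"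
  assumes "\<And>i j. i \<in> I \<Longrightarrow> j \<in> I \<Longrightarrow> (f i - f j) * (g i - g j) \<le> 0"
  shows "real (card I) * (\<Sum>i\<in>I. f i * g i) \<le> sum f I * sum g I"
  using Chebyshev_same[of I f "\<lambda>i. - g i"] assms
  by (simp add: sum_negf algebra_simps)

text \<open>One step of Maclaurin's inequality. Weights and partial derivatives are oppositely
  ordered by \<open>esym_remove_diff\<close>, so Chebyshev's inequality applies; Euler's identity
  and double counting evaluate the two sums.\<close>

lemma esym_Suc_le:
  assumes fin: "finite A" and nn: "\<And>v. v \<in> A \<Longrightarrow> 0 \<le> x v"
  shows "real (card A) * (real (Suc s) * esym (Suc s) A x)
    \<le> (real (card A) - real s) * (sum x A * esym s A x)"
proof -
  have "real (card A) * (\<Sum>v\<in>A. x v * esym s (A - {v}) x)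
      \<le> sum x A * (\<Sum>v\<in>A. esym s (A - {v}) x)"
  proof (rule Chebyshev_opposite)
    fix u v assume uv: "u \<in> A" "v \<in> A"
    show "(x u - x v) * (esym s (A - {u}) x - esym s (A - {v}) x) \<le> 0"
    proof (cases "u = v \<or> s = 0")
      case True
      then show ?thesis using fin by (auto simp: esym_0)
    next
      case False
      then obtain t where t: "s = Suc t" by (cases s) auto
      have "(x u - x v) * (esym s (A - {u}) x - esym s (A - {v}) x)
          = - ((x u - x v)\<^sup>2 * esym t (A - {u, v}) x)"
        unfolding t using False uv
        by (subst esym_remove_diff[OF fin]) (auto simp: power2_eq_square algebra_simps)
      also have "\<dots> \<le> 0" using nn by (auto intro!: mult_nonneg_nonneg esym_nonneg)
      finally show ?thesis .
    qed
  qed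
  then show ?thesis
    by (simp add: sum_mult_esym_remove[OF fin] sum_esym_remove[OF fin] algebra_simps del: of_nat_Suc)
qed

text \<open>Iterates \<open>esym_Suc_le\<close>. At mean weight 1 each step multiplies the bound by
  \<open>(card A - s) / (s + 1)\<close>, the ratio of consecutive binomial coefficients.\<close>

lemma esym_le_binomial:
  assumes fin: "finite A" and nn: "\<And>v. v \<in> A \<Longrightarrow> 0 \<le> x v" and sum: "sum x A = real (card A)"
    and "s \<le> card A"
  shows "esym s A x \<le> real (card A choose s)"
  using \<open>s \<le> card A\<close>
proof (induction s)
  case 0
  then show ?case using fin by (simp add: esym_0)
next
  case (Suc s)
  then have "0 < real (card A)" by simp
  moreover have "real (card A) * (real (Suc s) * esym (Suc s) A x)
      \<le> real (card A) * ((real (card A) - real s) * esym s A x)"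
    using esym_Suc_le[of A x s] fin nn by (simp add: sum algebra_simps)
  ultimately have "real (Suc s) * esym (Suc s) A x \<le> (real (card A) - real s) * esym s A x"
    by (simp only: mult_le_cancel_left_pos)
  also have "\<dots> \<le> (real (card A) - real s) * real (card A choose s)"
    using Suc by (intro mult_left_mono) auto
  also have "\<dots> = real ((card A - s) * (card A choose s))"
    using Suc.prems by (simp add: of_nat_diff)
  also have "(card A - s) * (card A choose s) = Suc s * (card A choose Suc s)"
    using binomial_absorb_comp[of "card A" s] binomial_absorption[of s "card A"] by simp
  finally have "real (Suc s) * esym (Suc s) A x \<le> real (Suc s) * real (card A choose Suc s)"
    by (simp only: of_nat_mult)
  then show ?case by (simp only: mult_le_cancel_left_pos of_nat_0_less_iff zero_less_Suc)
qed

section \<open>The inequality for class sizes and weights\<close>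

text \<open>For \<open>t = 1/M\<close> this is \<open>fact q * ((M - 1) gchoose q) / M ^ q\<close>.
  Reciprocals of class sizes are the right variable because mass times reciprocal size is the weight
  of a class, so tangent lines become linear in the weights.\<close>

definition falling_ratio :: "nat \<Rightarrow> real \<Rightarrow> real" where
  "falling_ratio q t = (\<Prod>j=1..q. 1 - real j * t)"

lemma falling_ratio_0 [simp]: "falling_ratio 0 t = 1"
  by (simp add: falling_ratio_def)

lemma falling_ratio_Suc: "falling_ratio (Suc q) t = falling_ratio q t * (1 - real (Suc q) * t)"
  by (simp add: falling_ratio_def)

lemma falling_ratio_nonneg:
  assumes "0 \<le> t" "real q * t \<le> 1"
  shows "0 \<le> falling_ratio q t"
  unfolding falling_ratio_def
proof (intro prod_nonneg)
  fix j assume "j \<in> {1..q}"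
  then have "real j * t \<le> real q * t" using assms by (intro mult_right_mono) auto
  then show "0 \<le> 1 - real j * t" using assms by linarith
qed

lemma falling_ratio_antimono:
  assumes "0 \<le> s" "s \<le> t" "real q * t \<le> 1"
  shows "falling_ratio q t \<le> falling_ratio q s"
  unfolding falling_ratio_def
proof (intro prod_mono)
  fix j assume j: "j \<in> {1..q}"
  then have "real j * t \<le> real q * t" using assms by (intro mult_right_mono) auto
  moreover have "real j * s \<le> real j * t" using assms by (intro mult_left_mono) auto
  ultimately show "0 \<le> 1 - real j * t \<and> 1 - real j * t \<le> 1 - real j * s" using assms by linarith
qed

lemma falling_ratio_inverse_nat_eq_0: "1 \<le> m \<Longrightarrow> m \<le> q \<Longrightarrow> falling_ratio q (1 / real m) = 0"
  by (auto simp: falling_ratio_def intro!: bexI[of _ m])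

lemma falling_ratio_inverse_nat_nonneg: "1 \<le> m \<Longrightarrow> 0 \<le> falling_ratio q (1 / real m)"
  by (cases "m \<le> q") (auto simp: falling_ratio_inverse_nat_eq_0 intro!: falling_ratio_nonneg simp: divide_simps)

text \<open>The product rule keeps the tangent line bound because all factors are monotone in the same
  direction.\<close>

lemma falling_ratio_tangent:
  assumes "0 \<le> t0" "real q * t0 \<le> 1"
  shows "\<exists>C\<ge>0. C \<le> real q * real (Suc q) / 2 * falling_ratio (q - 1) t0 \<and>
    (\<forall>t. 0 \<le> t \<longrightarrow> real q * t \<le> 1 \<longrightarrow> falling_ratio q t0 - C * (t - t0) \<le> falling_ratio q t)"
  using assms(2)
proof (induction q)
  case 0
  show ?case by (intro exI[of _ 0]) simp
next
  case (Suc q)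
  have q1: "real q * t \<le> 1" if "0 \<le> t" "real (Suc q) * t \<le> 1" for t
    using that by (simp add: algebra_simps)
  obtain C where C: "0 \<le> C" "C \<le> real q * real (Suc q) / 2 * falling_ratio (q - 1) t0"
    and tan: "\<And>t. 0 \<le> t \<Longrightarrow> real q * t \<le> 1 \<Longrightarrow> falling_ratio q t0 - C * (t - t0) \<le> falling_ratio q t"
    using Suc.IH q1[OF assms(1) Suc.prems] by blast
  let ?g = "\<lambda>t. 1 - real (Suc q) * t"
  \<comment> \<open>The product rule at \<open>t0\<close> with the sign reversed: \<open>?g\<close>
    has slope \<open>- Suc q\<close>, and \<open>- C\<close> stands for the slope of the first
    \<open>q\<close> factors.\<close>
  let ?C = "real (Suc q) * falling_ratio q t0 + ?g t0 * C"
  have g0: "0 \<le> ?g t0" using Suc.prems by simp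
  have p0: "0 \<le> falling_ratio q t0" using assms(1) q1[OF assms(1) Suc.prems] by (rule falling_ratio_nonneg)
  \<comment> \<open>Weakening \<open>?g t0\<close> to \<open>1 - q * t0\<close> supplies exactly the
    last factor that \<open>falling_ratio (q - 1) t0\<close> lacks.\<close>
  have "?g t0 * C \<le> real q * real (Suc q) / 2 * falling_ratio q t0"
  proof (cases q)
    case 0
    then show ?thesis using C by simp
  next
    case (Suc m)
    have pm: "0 \<le> falling_ratio (q - 1) t0"
      by (rule falling_ratio_nonneg[OF assms(1)])
        (use q1[OF assms(1) Suc.prems] assms(1) Suc in \<open>simp add: algebra_simps\<close>)
    have "?g t0 * C \<le> (1 - real q * t0) * C"
      using assms(1) C by (intro mult_right_mono) (auto simp: algebra_simps)
    also have "\<dots> \<le> (1 - real q * t0) * (real q * real (Suc q) / 2 * falling_ratio (q - 1) t0)"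
      using C q1[OF assms(1) Suc.prems] by (intro mult_left_mono) auto
    also have "\<dots> = real q * real (Suc q) / 2 * falling_ratio q t0"
      by (simp add: Suc falling_ratio_Suc)
    finally show ?thesis .
  qed
  then have "?C \<le> real (Suc q) * real (Suc (Suc q)) / 2 * falling_ratio (Suc q - 1) t0"
    by (simp add: field_simps)
  moreover have "0 \<le> ?C" using p0 g0 C by simp
  moreover have "falling_ratio (Suc q) t0 - ?C * (t - t0) \<le> falling_ratio (Suc q) t" if t: "0 \<le> t" "real (Suc q) * t \<le> 1" for t
  proof -
    \<comment> \<open>Expanded, this bounds the product at \<open>t\<close> from below by its
      linearization in the two factors. As \<open>?g\<close> is affine, only the tangent bound for
      the other factor remains to be inserted.\<close>
    have "0 \<le> (falling_ratio q t - falling_ratio q t0) * (?g t - ?g t0)"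
    proof (cases "t \<le> t0")
      case True
      then show ?thesis using falling_ratio_antimono[OF t(1) True q1[OF assms(1) Suc.prems]] t
        by (intro mult_nonneg_nonneg) (auto intro!: mult_left_mono)
    next
      case False
      then show ?thesis using falling_ratio_antimono[OF assms(1) _ q1[OF t]] t
        by (intro mult_nonpos_nonpos) (auto intro!: mult_left_mono)
    qed
    moreover have "?g t0 * (falling_ratio q t0 - C * (t - t0)) \<le> ?g t0 * falling_ratio q t"
      using tan[OF t(1) q1[OF t]] g0 by (rule mult_left_mono)
    ultimately show ?thesis by (simp add: falling_ratio_Suc algebra_simps)
  qed
  ultimately show ?case by blast
qed

text \<open>At \<open>t = 1/m\<close> the restriction \<open>q t \<le> 1\<close> can be dropped: for \<open>m < q\<close> the product has a zero
  factor, while the tangent line is already nonpositive beyond \<open>1/q\<close>.\<close>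

lemma falling_ratio_tangent_nat:
  assumes "0 \<le> t0" "real q * t0 \<le> 1"
  obtains C where "0 \<le> C" "C \<le> real q * real (Suc q) / 2 * falling_ratio (q - 1) t0"
    "\<And>m. 1 \<le> m \<Longrightarrow> falling_ratio q t0 - C * (1 / real m - t0) \<le> falling_ratio q (1 / real m)"
proof -
  obtain C where C: "0 \<le> C" "C \<le> real q * real (Suc q) / 2 * falling_ratio (q - 1) t0"
    and tan: "\<And>t. 0 \<le> t \<Longrightarrow> real q * t \<le> 1 \<Longrightarrow> falling_ratio q t0 - C * (t - t0) \<le> falling_ratio q t"
    using falling_ratio_tangent[OF assms] by blast
  have "falling_ratio q t0 - C * (1 / real m - t0) \<le> falling_ratio q (1 / real m)" if m: "1 \<le> m" for m
  proof (cases "q \<le> m")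
    case True
    then show ?thesis using m by (intro tan) auto
  next
    case False
    have "C * (1 / real q - t0) \<le> C * (1 / real m - t0)"
      using False m C by (intro mult_left_mono) (auto simp: frac_le)
    moreover have "falling_ratio q t0 - C * (1 / real q - t0) \<le> falling_ratio q (1 / real q)"
      using False m by (intro tan) auto
    ultimately show ?thesis using False m by (simp add: falling_ratio_inverse_nat_eq_0)
  qed
  with C that show thesis by blast
qed

lemma gbinomial_pred_eq_falling_ratio:
  assumes "M \<noteq> 0"
  shows "fact q * ((M - 1) gchoose q) = M ^ q * falling_ratio q (1 / M)"
proof -
  have "fact q * ((M - 1) gchoose q) = (\<Prod>i = 0..<q. M - 1 - real i)"
    by (simp add: gbinomial_prod_rev)
  also have "\<dots> = (\<Prod>i = 0..<q. M * (1 - real (Suc i) * (1 / M)))"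
    using assms by (intro prod.cong) (auto simp: field_simps)
  also have "\<dots> = M ^ q * (\<Prod>i = 0..<q. 1 - real (Suc i) * (1 / M))"
    by (simp add: prod.distrib)
  also have "(\<Prod>i = 0..<q. 1 - real (Suc i) * (1 / M)) = falling_ratio q (1 / M)"
    unfolding falling_ratio_def by (rule prod.reindex_bij_witness[of _ "\<lambda>j. j - 1" Suc]) auto
  finally show ?thesis .
qed

lemma binomial_pred_eq_falling_ratio:
  assumes "1 \<le> m"
  shows "fact q * real ((m - 1) choose q) = real m ^ q * falling_ratio q (1 / real m)"
proof -
  have "real ((m - 1) choose q) = (real m - 1) gchoose q"
    using assms by (simp add: binomial_gbinomial of_nat_diff)
  then show ?thesis using gbinomial_pred_eq_falling_ratio[of "real m" q] assms by simp
qed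

lemma Suc_times_gbinomial:
  fixes M :: real
  shows "real (Suc q) * (M gchoose Suc q) = M * ((M - 1) gchoose q)"
  using gbinomial_absorption'[of "Suc q" M] by (simp del: of_nat_Suc)

text \<open>Power mean estimates: \<open>y\<close> and \<open>y ^ s\<close> are ordered alike, so
  Chebyshev's inequality raises the exponent by one, and induction from exponent 0 gives the first
  part.\<close>

lemma power_sum_lower_bound:
  fixes y :: "'i \<Rightarrow> real"
  assumes fin: "finite I" and "I \<noteq> {}" and nn: "\<And>i. i \<in> I \<Longrightarrow> 0 \<le> y i" and sum: "sum y I = n"
  shows "real (card I) * (n / real (card I)) ^ s \<le> (\<Sum>i\<in>I. y i ^ s)"
    and "n * (\<Sum>i\<in>I. y i ^ s) \<le> real (card I) * (\<Sum>i\<in>I. y i ^ Suc s)"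
proof -
  have step: "n * (\<Sum>i\<in>I. y i ^ s) \<le> real (card I) * (\<Sum>i\<in>I. y i ^ Suc s)" for s
  proof -
    have "sum y I * (\<Sum>i\<in>I. y i ^ s) \<le> real (card I) * (\<Sum>i\<in>I. y i * y i ^ s)"
    proof (rule Chebyshev_same)
      fix i j assume ij: "i \<in> I" "j \<in> I"
      show "0 \<le> (y i - y j) * (y i ^ s - y j ^ s)"
      proof (cases "y i \<le> y j")
        case True
        then show ?thesis using ij nn by (intro mult_nonpos_nonpos) (auto intro!: power_mono)
      next
        case False
        then show ?thesis using ij nn by (intro mult_nonneg_nonneg) (auto intro!: power_mono)
      qed
    qed
    then show ?thesis by (simp add: sum)
  qed
  show "n * (\<Sum>i\<in>I. y i ^ s) \<le> real (card I) * (\<Sum>i\<in>I. y i ^ Suc s)" by (rule step)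
  have k: "0 < real (card I)" using assms by (simp add: card_gt_0_iff)
  have n: "0 \<le> n" using sum nn by (auto intro: sum_nonneg)
  show "real (card I) * (n / real (card I)) ^ s \<le> (\<Sum>i\<in>I. y i ^ s)"
  proof (induction s)
    case (Suc s)
    have "real (card I) * (n / real (card I)) ^ Suc s = n / real (card I) * (real (card I) * (n / real (card I)) ^ s)"
      by simp
    also have "\<dots> \<le> n / real (card I) * (\<Sum>i\<in>I. y i ^ s)"
      using Suc n by (intro mult_left_mono) auto
    also have "\<dots> \<le> (\<Sum>i\<in>I. y i ^ Suc s)"
      using step[of s] k by (simp add: field_simps)
    finally show ?case .
  qed simp
qed

text \<open>\<open>D = \<Sum>a\<^sub>i - k\<close> measures the deviation from equal classes. The tangent line bound on \<open>\<Sum>B\<^sub>i\<close> loses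
  a multiple of \<open>D\<close>, which the gain \<open>L D\<close> in Chebyshev's inequality for \<open>\<Sum>N\<^sub>i B\<^sub>i\<close> compensates.\<close>

lemma weighted_sum_lower_bound:
  fixes N :: "'i \<Rightarrow> nat" and a B :: "'i \<Rightarrow> real"
  assumes fin: "finite I" and k: "2 \<le> card I" and n: "q * card I < n" and q: "1 \<le> q"
    and N: "\<And>i. i \<in> I \<Longrightarrow> 1 \<le> N i" and a: "\<And>i. i \<in> I \<Longrightarrow> 0 < a i"
    and sumN: "(\<Sum>i\<in>I. N i) = n" and sumNa: "(\<Sum>i\<in>I. real (N i) * a i) = real n"
    and B: "\<And>i. i \<in> I \<Longrightarrow> B i = real ((N i - 1) choose q) * a i ^ q"
    and same: "\<And>i j. i \<in> I \<Longrightarrow> j \<in> I \<Longrightarrow> a i = a j \<Longrightarrow> B i = B j"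
    and L: "L = real q * real (Suc q) / 2 * falling_ratio (q - 1) (1 / real n) * (real n / 2) ^ (q - 1)"
    and gap: "\<And>i j. i \<in> I \<Longrightarrow> j \<in> I \<Longrightarrow> a j < a i \<Longrightarrow> L * (a i - a j) < fact q * (B j - B i)"
  shows "real (Suc q) * (real (card I) * ((real n / real (card I)) gchoose Suc q)) \<le> (\<Sum>i\<in>I. real (N i) * B i)"
proof -
  define k' where "k' = real (card I)"
  \<comment> \<open>\<open>M\<close> is the mean class size and \<open>y i\<close> below is the mass
    of class \<open>i\<close>; as the masses also add up to \<open>n\<close>, \<open>M\<close> is
    the mean mass too.\<close>
  define M where "M = real n / k'"
  define y where "y = (\<lambda>i. real (N i) * a i)"
  have k': "2 \<le> k'" using k by (simp add: k'_def)
  have qn: "real q * k' < real n"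
    using n unfolding k'_def by (metis of_nat_less_iff of_nat_mult)
  have n0: "0 < real n" using n by linarith
  have nq: "real q \<le> real n" using n k q by (metis mult_le_mono2 nat_mult_1_right le_trans less_imp_le of_nat_le_iff one_le_numeral)
  have M0: "0 < M" using n0 k' by (simp add: M_def)
  have kM: "k' * M = real n" using k' by (simp add: M_def)
  have yp: "0 < y i" if "i \<in> I" for i using N[OF that] a[OF that] by (simp add: y_def)
  have ny: "real (N i) * a i = y i" for i by (simp add: y_def)
  have sumy: "sum y I = real n" using sumNa by (simp add: y_def)
  have neI: "I \<noteq> {}" using k by auto
  have L0: "0 \<le> L"
    unfolding L using nq n0
    by (intro mult_nonneg_nonneg falling_ratio_nonneg) (auto simp: divide_simps)
  have B0: "0 \<le> B i" if "i \<in> I" for i using B[OF that] a[OF that] by simp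
  have Bpsi: "fact q * B i = y i ^ q * falling_ratio q (1 / real (N i))" if "i \<in> I" for i
    using binomial_pred_eq_falling_ratio[OF N[OF that], of q] B[OF that]
    by (simp add: y_def power_mult_distrib algebra_simps)
  have aN: "1 / real (N i) = a i / y i" if "i \<in> I" for i
    using a[OF that] by (simp add: y_def)
  have gapB: "B i < B j" if "i \<in> I" "j \<in> I" "a j < a i" for i j
  proof -
    have "0 \<le> L * (a i - a j)" using L0 that by simp
    also have "\<dots> < fact q * (B j - B i)" using gap that by blast
    finally show ?thesis by (simp add: zero_less_mult_iff)
  qed
  \<comment> \<open>Otherwise class \<open>i\<close> would have at least as many vertices and
    heavier weights, hence a \<open>B\<close> at least as large, against
    \<open>gapB\<close>.\<close>
  have gapN: "N i < N j" if ij: "i \<in> I" "j \<in> I" "a j < a i" for i j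
  proof (rule ccontr)
    assume "\<not> N i < N j"
    then have "real ((N j - 1) choose q) * a j ^ q \<le> real ((N i - 1) choose q) * a i ^ q"
      using ij a[of j] by (intro mult_mono power_mono) (auto intro!: binomial_right_mono)
    then show False using gapB[OF ij] B ij by simp
  qed
  have qN: "q < N j" if ij: "i \<in> I" "j \<in> I" "a j < a i" for i j
  proof (rule ccontr)
    assume "\<not> q < N j"
    then have "B j = 0" using B[OF ij(2)] N[OF ij(2)] by (simp add: binomial_eq_0)
    then show False using gapB[OF ij] B0[OF ij(1)] by simp
  qed
  \<comment> \<open>If class \<open>i\<close> had at least the mass of class \<open>j\<close>, then
    \<open>y j \<le> n/2\<close>, and the tangent bound at \<open>1/N j\<close> would limit
    \<open>fact q * (B j - B i)\<close> to \<open>L * (a i - a j)\<close>, against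
    \<open>gap\<close>.\<close>
  have gapy: "y i < y j" if ij: "i \<in> I" "j \<in> I" "a j < a i" for i j
  proof (rule ccontr)
    assume "\<not> y i < y j"
    then have yij: "y j \<le> y i" by simp
    have "i \<noteq> j" using ij by auto
    then have "y i + y j = (\<Sum>l\<in>{i, j}. y l)" by simp
    also have "\<dots> \<le> sum y I" using ij yp by (intro sum_mono2 fin) (auto intro: less_imp_le)
    finally have yn: "y j \<le> real n / 2" using yij sumy by simp
    have Nj: "real q < real (N j)" using qN[OF ij] by simp
    have t0: "0 \<le> 1 / real (N j)" "real q * (1 / real (N j)) \<le> 1" using Nj by (auto simp: divide_simps)
    obtain C where C: "0 \<le> C" "C \<le> real q * real (Suc q) / 2 * falling_ratio (q - 1) (1 / real (N j))"
      and tan: "\<And>m. 1 \<le> m \<Longrightarrow> falling_ratio q (1 / real (N j)) - C * (1 / real m - 1 / real (N j)) \<le> falling_ratio q (1 / real m)"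
      using falling_ratio_tangent_nat[OF t0] by blast
    have yq: "y j ^ q = y j ^ (q - 1) * y j" using q by (cases q) auto
    have "fact q * B j - C * y j ^ (q - 1) * (a i - a j)
        = y j ^ q * (falling_ratio q (1 / real (N j)) - C * (a i / y j - a j / y j))"
      using Bpsi[OF ij(2)] yp[OF ij(2)] by (simp add: yq field_simps)
    also have "\<dots> \<le> y j ^ q * (falling_ratio q (1 / real (N j)) - C * (1 / real (N i) - 1 / real (N j)))"
    proof -
      have "a i / y i \<le> a i / y j"
        using yij yp[OF ij(2)] a[OF ij(1)] by (intro divide_left_mono) auto
      then show ?thesis
        using C yp[OF ij(2)] by (intro mult_left_mono diff_left_mono) (auto simp: aN ij)
    qed
    also have "\<dots> \<le> y j ^ q * falling_ratio q (1 / real (N i))"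
      using tan[OF N[OF ij(1)]] yp[OF ij(2)] by (intro mult_left_mono) auto
    also have "\<dots> \<le> y i ^ q * falling_ratio q (1 / real (N i))"
      using yij yp[OF ij(2)] falling_ratio_inverse_nat_nonneg[OF N[OF ij(1)]]
      by (intro mult_right_mono power_mono) auto
    also have "\<dots> = fact q * B i" using Bpsi[OF ij(1)] by simp
    finally have 1: "fact q * (B j - B i) \<le> C * y j ^ (q - 1) * (a i - a j)"
      by (simp add: algebra_simps)
    have Njn: "N j \<le> n" using member_le_sum[of j I N] fin ij by (simp add: sumN)
    \<comment> \<open>\<open>N j \<le> n\<close> moves the slope bound from \<open>1/N j\<close> to
      \<open>1/n\<close>, which makes it independent of the class.\<close>
    have "C * y j ^ (q - 1) \<le> (real q * real (Suc q) / 2 * falling_ratio (q - 1) (1 / real n)) * (real n / 2) ^ (q - 1)"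
    proof (intro mult_mono power_mono order.trans[OF C(2)] mult_left_mono falling_ratio_antimono yn)
      show "1 / real n \<le> 1 / real (N j)" using Njn Nj by (intro divide_left_mono) auto
      have "real (q - 1) \<le> real (N j)" using Nj by linarith
      then show "real (q - 1) * (1 / real (N j)) \<le> 1" using Nj by (auto simp: divide_simps)
      show "0 \<le> real q * real (Suc q) / 2 * falling_ratio (q - 1) (1 / real n)"
        using nq n0 by (intro mult_nonneg_nonneg falling_ratio_nonneg) (auto simp: divide_simps)
      show "0 \<le> y j ^ (q - 1)" using yp[OF ij(2)] by simp
    qed (use C yp[OF ij(2)] falling_ratio_inverse_nat_nonneg[OF N[OF ij(2)], of "q - 1"] in auto)
    then have "C * y j ^ (q - 1) * (a i - a j) \<le> L * (a i - a j)"
      unfolding L using ij by (intro mult_right_mono) auto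
    then show False using 1 gap[OF ij] by simp
  qed
  have trich: "P" if "a i < a j \<Longrightarrow> P" "a j < a i \<Longrightarrow> P" "a i = a j \<Longrightarrow> P" for i j P
    using that by linarith
  define D where "D = sum a I - k'"
  define SB where "SB = sum B I"
  have sN: "(\<Sum>i\<in>I. real (N i)) = real n" using sumN by (metis of_nat_sum)
  have nD: "real n * D = real n * sum a I - k' * real n" by (simp add: D_def algebra_simps)
  have D0: "0 \<le> D"
  proof -
    have "k' * (\<Sum>i\<in>I. real (N i) * a i) \<le> (\<Sum>i\<in>I. real (N i)) * sum a I"
      unfolding k'_def
    proof (rule Chebyshev_opposite)
      fix i j assume ij: "i \<in> I" "j \<in> I"
      show "(real (N i) - real (N j)) * (a i - a j) \<le> 0"
        by (rule trich[of i j]) (use gapN[of i j] gapN[of j i] ij in \<open>auto simp: mult_le_0_iff\<close>)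
    qed
    then have "0 \<le> real n * D" by (simp add: sumNa sN nD)
    then show ?thesis using n0 by (simp add: zero_le_mult_iff)
  qed
  \<comment> \<open>By \<open>gap\<close> and \<open>gapN\<close> the numbers
    \<open>fact q * B i + L * a i\<close> are still ordered like \<open>N i\<close>. Applying
    Chebyshev's inequality to them, and not just to \<open>B i\<close>, produces the surplus
    \<open>L * n * D\<close>.\<close>
  have main1: "L * (real n * D) \<le> fact q * (k' * (\<Sum>i\<in>I. real (N i) * B i) - real n * SB)"
  proof -
    have "0 \<le> (\<Sum>i\<in>I. \<Sum>j\<in>I. (real (N i) - real (N j)) * ((fact q * B i + L * a i) - (fact q * B j + L * a j)))"
    proof (intro sum_nonneg)
      fix i j assume ij: "i \<in> I" "j \<in> I"
      show "0 \<le> (real (N i) - real (N j)) * ((fact q * B i + L * a i) - (fact q * B j + L * a j))"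
      proof (rule trich[of i j])
        assume "a i < a j"
        then show ?thesis using gapN[of j i] gap[of j i] ij
          by (intro mult_nonneg_nonneg) (auto simp: algebra_simps)
      next
        assume "a j < a i"
        then show ?thesis using gapN[of i j] gap[of i j] ij
          by (intro mult_nonpos_nonpos) (auto simp: algebra_simps)
      next
        assume "a i = a j"
        then show ?thesis using same[of i j] ij by simp
      qed
    qed
    then have "0 \<le> k' * (\<Sum>i\<in>I. real (N i) * (fact q * B i + L * a i)) - real n * (\<Sum>i\<in>I. fact q * B i + L * a i)"
      unfolding Chebyshev_identity by (simp add: k'_def sN)
    also have "(\<Sum>i\<in>I. real (N i) * (fact q * B i + L * a i)) = fact q * (\<Sum>i\<in>I. real (N i) * B i) + L * real n"
      unfolding sumNa[symmetric] by (simp add: sum_distrib_left sum.distrib algebra_simps)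
    also have "(\<Sum>i\<in>I. fact q * B i + L * a i) = fact q * SB + L * sum a I"
      by (simp add: SB_def sum_distrib_left sum.distrib)
    finally show ?thesis unfolding nD by (simp add: algebra_simps)
  qed
  \<comment> \<open>The second use of the tangent bound is at the mean class size, which is
    admissible because \<open>q * k < n\<close>.\<close>
  have t0: "0 \<le> 1 / M" "real q * (1 / M) \<le> 1"
    using M0 qn k' by (auto simp: M_def divide_simps)
  obtain C where C: "0 \<le> C" "C \<le> real q * real (Suc q) / 2 * falling_ratio (q - 1) (1 / M)"
    and tan: "\<And>m. 1 \<le> m \<Longrightarrow> falling_ratio q (1 / M) - C * (1 / real m - 1 / M) \<le> falling_ratio q (1 / real m)"
    using falling_ratio_tangent_nat[OF t0] by blast
  have "real (q - 1) * (1 / M) \<le> real q * (1 / M)" using M0 by (intro mult_right_mono) auto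
  then have q1M: "real (q - 1) * (1 / M) \<le> 1" using t0 by linarith
  \<comment> \<open>With at least two classes \<open>M \<le> n/2\<close>, so the same
    \<open>L\<close> also dominates this slope.\<close>
  have CL: "C * M ^ (q - 1) \<le> L"
    unfolding L
  proof (intro mult_mono power_mono order.trans[OF C(2)] mult_left_mono falling_ratio_antimono)
    show "1 / real n \<le> 1 / M" using M0 n0 k' by (auto simp: M_def divide_simps)
    show "real (q - 1) * (1 / M) \<le> 1" by (rule q1M)
    show "0 \<le> real q * real (Suc q) / 2 * falling_ratio (q - 1) (1 / real n)"
      using nq n0 by (intro mult_nonneg_nonneg falling_ratio_nonneg) (auto simp: divide_simps)
    show "M \<le> real n / 2" using k' n0 unfolding M_def by (intro divide_left_mono) auto
  qed (use C M0 falling_ratio_nonneg[OF t0(1) q1M] in auto)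
  define \<psi> where "\<psi> = falling_ratio q (1 / M)"
  define S where "S = (\<Sum>i\<in>I. y i ^ (q - 1))"
  have psi0: "0 \<le> \<psi>" unfolding \<psi>_def by (rule falling_ratio_nonneg[OF t0])
  have S_ge: "k' * M ^ (q - 1) \<le> S"
    unfolding S_def M_def k'_def
    using yp by (intro power_sum_lower_bound(1) fin neI sumy) (auto intro: less_imp_le)
  have Sq: "real n * S \<le> k' * (\<Sum>i\<in>I. y i ^ q)"
    using power_sum_lower_bound(2)[OF fin neI _ sumy, of "q - 1"] yp q
    unfolding S_def k'_def by (simp add: less_imp_le)
  have ay: "k' * (\<Sum>i\<in>I. a i * y i ^ (q - 1)) \<le> sum a I * S"
    unfolding S_def k'_def
  proof (rule Chebyshev_opposite)
    fix i j assume ij: "i \<in> I" "j \<in> I"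
    show "(a i - a j) * (y i ^ (q - 1) - y j ^ (q - 1)) \<le> 0"
    proof (rule trich[of i j])
      assume "a i < a j"
      then show ?thesis using gapy[of j i] ij yp[of j]
        by (auto simp: mult_le_0_iff intro!: power_mono)
    next
      assume "a j < a i"
      then show ?thesis using gapy[of i j] ij yp[of i]
        by (auto simp: mult_le_0_iff intro!: power_mono)
    qed simp
  qed
  \<comment> \<open>The tangent bounds are summed using
    \<open>y i ^ q / N i = a i * y i ^ (q - 1)\<close>. Then \<open>Sq\<close> and
    \<open>ay\<close>, the latter resting on \<open>gapy\<close>, express both sums through
    \<open>S\<close>.\<close>
  have main2: "S * (\<psi> * real n - C * D) \<le> k' * (fact q * SB)"
  proof -
    have "(\<Sum>i\<in>I. (\<psi> + C / M) * y i ^ q - C * (a i * y i ^ (q - 1))) \<le> (\<Sum>i\<in>I. fact q * B i)"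
    proof (rule sum_mono)
      fix i assume i: "i \<in> I"
      have yq: "y i ^ q = y i ^ (q - 1) * y i" using q by (cases q) auto
      have "(\<psi> + C / M) * y i ^ q - C * (a i * y i ^ (q - 1)) = y i ^ q * (\<psi> - C * (1 / real (N i) - 1 / M))"
        using yp[OF i] unfolding aN[OF i] by (simp add: yq field_simps)
      also have "\<dots> \<le> y i ^ q * falling_ratio q (1 / real (N i))"
        using tan[OF N[OF i]] yp[OF i] unfolding \<psi>_def by (intro mult_left_mono) auto
      finally show "(\<psi> + C / M) * y i ^ q - C * (a i * y i ^ (q - 1)) \<le> fact q * B i"
        by (simp add: Bpsi[OF i])
    qed
    then have 1: "(\<psi> + C / M) * (\<Sum>i\<in>I. y i ^ q) - C * (\<Sum>i\<in>I. a i * y i ^ (q - 1)) \<le> fact q * SB"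
      by (simp add: SB_def sum_subtractf flip: sum_distrib_left)
    have "S * (\<psi> * real n - C * D) = (\<psi> + C / M) * (real n * S) - C * (sum a I * S)"
      using M0 by (simp add: D_def kM[symmetric] field_simps)
    also have "\<dots> \<le> (\<psi> + C / M) * (k' * (\<Sum>i\<in>I. y i ^ q)) - C * (k' * (\<Sum>i\<in>I. a i * y i ^ (q - 1)))"
      using Sq ay C psi0 M0 by (intro diff_mono mult_left_mono) auto
    also have "\<dots> = k' * ((\<psi> + C / M) * (\<Sum>i\<in>I. y i ^ q) - C * (\<Sum>i\<in>I. a i * y i ^ (q - 1)))"
      by (simp add: algebra_simps)
    also have "\<dots> \<le> k' * (fact q * SB)" using 1 k' by (intro mult_left_mono) auto
    finally show ?thesis .
  qed
  have LD: "C * M ^ (q - 1) * D \<le> L * D" using CL D0 by (rule mult_right_mono)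
  \<comment> \<open>If \<open>\<psi> * n - C * D\<close> is negative, the lower bound on
    \<open>S\<close> cannot be multiplied by it, but then the left side is already at most
    \<open>L * D\<close>.\<close>
  have main3: "M ^ (q - 1) * (\<psi> * real n) \<le> fact q * SB + L * D"
  proof (cases "C * D \<le> \<psi> * real n")
    case True
    have "k' * (M ^ (q - 1) * (\<psi> * real n - C * D)) \<le> S * (\<psi> * real n - C * D)"
      using mult_right_mono[OF S_ge, of "\<psi> * real n - C * D"] True by (simp add: mult.assoc)
    also have "\<dots> \<le> k' * (fact q * SB)" by (rule main2)
    finally have "M ^ (q - 1) * (\<psi> * real n - C * D) \<le> fact q * SB" using k' by simp
    then show ?thesis using LD by (simp add: algebra_simps)
  next
    case False
    have "M ^ (q - 1) * (\<psi> * real n) \<le> M ^ (q - 1) * (C * D)"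
      using False M0 by (intro mult_left_mono) auto
    moreover have "0 \<le> fact q * SB" unfolding SB_def using B0 by (intro mult_nonneg_nonneg sum_nonneg) auto
    ultimately show ?thesis using LD by (simp add: algebra_simps)
  qed
  have "k' * (fact q * (real (Suc q) * (k' * (M gchoose Suc q)))) = k' * (k' * (M * (fact q * ((M - 1) gchoose q))))"
    unfolding mult.left_commute[of "real (Suc q)" k'] Suc_times_gbinomial by (simp add: algebra_simps)
  also have "fact q * ((M - 1) gchoose q) = M ^ (q - 1) * M * \<psi>"
    using gbinomial_pred_eq_falling_ratio[of M q] M0 q by (cases q) (auto simp: \<psi>_def)
  also have "k' * (k' * (M * (M ^ (q - 1) * M * \<psi>))) = (k' * M) * (M ^ (q - 1) * (\<psi> * (k' * M)))"
    by (simp add: algebra_simps)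
  also have "\<dots> \<le> real n * (fact q * SB + L * D)"
    unfolding kM using main3 n0 by (intro mult_left_mono) auto
  also have "\<dots> \<le> k' * (fact q * (\<Sum>i\<in>I. real (N i) * B i))"
    using main1 by (simp add: algebra_simps)
  finally have "real (Suc q) * (k' * (M gchoose Suc q)) \<le> (\<Sum>i\<in>I. real (N i) * B i)"
    using k' by (simp only: mult_le_cancel_left_pos fact_gt_zero)
  then show ?thesis by (simp add: k'_def M_def)
qed

section \<open>Maximizers of the crossing polynomial\<close>

text \<open>Effect of moving weight \<open>t\<close> from \<open>v\<close> to \<open>u\<close>. If
  both lie in \<open>A\<close>, the sum \<open>x u + x v\<close> is preserved and only the product
  \<open>x u * x v\<close> changes; otherwise the dependence on \<open>t\<close> is at most
  linear.\<close>

lemma esym_shift: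
  fixes x :: "'a \<Rightarrow> real" and t :: real
  assumes fin: "finite A" and uv: "u \<noteq> v"
  defines "y \<equiv> x(u := x u + t, v := x v - t)"
  shows "u \<in> A \<Longrightarrow> v \<in> A \<Longrightarrow> esym (Suc (Suc s)) A y =
      esym (Suc (Suc s)) A x + (t * (x v - x u) - t\<^sup>2) * esym s (A - {u, v}) x"
    and "u \<in> A \<Longrightarrow> v \<notin> A \<Longrightarrow> esym (Suc s) A y = esym (Suc s) A x + t * esym s (A - {u}) x"
    and "u \<notin> A \<Longrightarrow> v \<in> A \<Longrightarrow> esym (Suc s) A y = esym (Suc s) A x - t * esym s (A - {v}) x"
    and "u \<notin> A \<Longrightarrow> v \<notin> A \<Longrightarrow> esym s A y = esym s A x"
proof -
  have eq: "esym l (A - {u, v}) y = esym l (A - {u, v}) x" for l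
    by (rule esym_cong) (auto simp: y_def)
  have equ: "v \<notin> A \<Longrightarrow> esym l (A - {u}) y = esym l (A - {u}) x" for l
    by (rule esym_cong) (auto simp: y_def)
  have eqv: "u \<notin> A \<Longrightarrow> esym l (A - {v}) y = esym l (A - {v}) x" for l
    by (rule esym_cong) (auto simp: y_def)
  show "u \<in> A \<Longrightarrow> v \<in> A \<Longrightarrow> esym (Suc (Suc s)) A y =
      esym (Suc (Suc s)) A x + (t * (x v - x u) - t\<^sup>2) * esym s (A - {u, v}) x"
    using uv by (simp add: esym_remove2[OF fin _ _ uv] eq)
      (simp add: y_def algebra_simps power2_eq_square)
  show "u \<in> A \<Longrightarrow> v \<notin> A \<Longrightarrow> esym (Suc s) A y = esym (Suc s) A x + t * esym s (A - {u}) x"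
    using uv by (simp add: esym_remove[OF fin, of u] equ) (simp add: y_def algebra_simps)
  show "u \<notin> A \<Longrightarrow> v \<in> A \<Longrightarrow> esym (Suc s) A y = esym (Suc s) A x - t * esym s (A - {v}) x"
    using uv by (simp add: esym_remove[OF fin, of v] eqv) (simp add: y_def algebra_simps)
  show "u \<notin> A \<Longrightarrow> v \<notin> A \<Longrightarrow> esym s A y = esym s A x"
    by (rule esym_cong) (auto simp: y_def)
qed

section \<open>Crossing sets of a colouring\<close>

definition colour_class :: "'a set \<Rightarrow> ('a \<Rightarrow> 'i) \<Rightarrow> 'i \<Rightarrow> 'a set" where
  "colour_class V c i = {v \<in> V. c v = i}"

text \<open>These are the edges of the largest \<open>r\<close>-graph on \<open>V\<close> that
  \<open>c\<close> colours properly. Every properly coloured \<open>r\<close>-graph is contained in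
  it, so it suffices to bound this one.\<close>

definition crossing_sets :: "nat \<Rightarrow> 'a set \<Rightarrow> ('a \<Rightarrow> 'i) \<Rightarrow> 'a set set" where
  "crossing_sets r V c = {S. S \<subseteq> V \<and> card S = r \<and> \<not> (\<exists>i. S \<subseteq> colour_class V c i)}"

definition crossing :: "nat \<Rightarrow> 'a set \<Rightarrow> ('a \<Rightarrow> 'i) \<Rightarrow> ('a \<Rightarrow> real) \<Rightarrow> real" where
  "crossing r V c x = (\<Sum>S\<in>crossing_sets r V c. \<Prod>v\<in>S. x v)"

lemma finite_colour_class [simp]: "finite V \<Longrightarrow> finite (colour_class V c i)"
  by (simp add: colour_class_def)

lemma finite_crossing_sets: "finite V \<Longrightarrow> finite (crossing_sets r V c)"
  by (rule finite_subset[of _ "Pow V"]) (auto simp: crossing_sets_def)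

text \<open>From all \<open>r\<close>-sets those inside one class are subtracted. The condition
  \<open>1 \<le> r\<close> excludes the empty set, which lies in every class and would be subtracted
  repeatedly.\<close>

lemma crossing_eq_esym:
  assumes fin: "finite V" and r: "1 \<le> r"
  shows "crossing r V c x = esym r V x - (\<Sum>i\<in>c ` V. esym r (colour_class V c i) x)"
proof -
  let ?M = "\<lambda>i. {S. S \<subseteq> colour_class V c i \<and> card S = r}"
  have finM: "finite (?M i)" for i
    by (rule finite_subset[of _ "Pow V"]) (use fin in \<open>auto simp: colour_class_def\<close>)
  have "{S. S \<subseteq> V \<and> card S = r} = crossing_sets r V c \<union> (\<Union>i\<in>c ` V. ?M i)" (is "?A = ?B")
  proof
    show "?A \<subseteq> ?B"
    proof
      fix S assume S: "S \<in> ?A"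
      show "S \<in> ?B"
      proof (cases "\<exists>i. S \<subseteq> colour_class V c i")
        case True
        then obtain i where i: "S \<subseteq> colour_class V c i" by blast
        moreover have "S \<noteq> {}" using S r by auto
        ultimately have "i \<in> c ` V" by (auto simp: colour_class_def)
        then show ?thesis using i S by blast
      qed (use S in \<open>auto simp: crossing_sets_def\<close>)
    qed
  qed (auto simp: crossing_sets_def colour_class_def)
  then have "esym r V x = (\<Sum>S\<in>crossing_sets r V c \<union> (\<Union>i\<in>c ` V. ?M i). \<Prod>v\<in>S. x v)"
    by (simp add: esym_def)
  also have "\<dots> = crossing r V c x + (\<Sum>S\<in>(\<Union>i\<in>c ` V. ?M i). \<Prod>v\<in>S. x v)"
    unfolding crossing_def using fin finM
    by (intro sum.union_disjoint) (auto simp: finite_crossing_sets crossing_sets_def)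
  also have "(\<Sum>S\<in>(\<Union>i\<in>c ` V. ?M i). \<Prod>v\<in>S. x v) = (\<Sum>i\<in>c ` V. esym r (colour_class V c i) x)"
    unfolding esym_def
  proof (rule sum.UNION_disjoint)
    show "\<forall>i\<in>c ` V. \<forall>j\<in>c ` V. i \<noteq> j \<longrightarrow> ?M i \<inter> ?M j = {}"
    proof (intro ballI impI equals0I)
      fix i j S assume "i \<noteq> j" and S: "S \<in> ?M i \<inter> ?M j"
      then have "S = {}" by (auto simp: colour_class_def)
      then show False using S r by simp
    qed
  qed (use fin finM in auto)
  finally show ?thesis by simp
qed

lemma crossing_shift_same:
  fixes x :: "'a \<Rightarrow> real"
  assumes fin: "finite V" and uv: "u \<in> V" "v \<in> V" "u \<noteq> v" and c: "c u = c v"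
  shows "crossing (Suc (Suc s)) V c (x(u := x u + t, v := x v - t)) = crossing (Suc (Suc s)) V c x
    + (t * (x v - x u) - t\<^sup>2) * (esym s (V - {u, v}) x - esym s (colour_class V c (c u) - {u, v}) x)"
proof -
  let ?y = "x(u := x u + t, v := x v - t)" and ?P = "colour_class V c" and ?r = "Suc (Suc s)"
  have fI: "finite (c ` V)" "c u \<in> c ` V" using fin uv by auto
  have "(\<Sum>i\<in>c ` V - {c u}. esym ?r (?P i) ?y) = (\<Sum>i\<in>c ` V - {c u}. esym ?r (?P i) x)"
    using fin uv c by (intro sum.cong refl esym_shift(4)) (auto simp: colour_class_def)
  moreover have "esym ?r (?P (c u)) ?y = esym ?r (?P (c u)) x + (t * (x v - x u) - t\<^sup>2) * esym s (?P (c u) - {u, v}) x"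
    using fin uv c by (intro esym_shift(1)) (auto simp: colour_class_def)
  moreover have "esym ?r V ?y = esym ?r V x + (t * (x v - x u) - t\<^sup>2) * esym s (V - {u, v}) x"
    using fin uv by (intro esym_shift(1)) auto
  ultimately show ?thesis
    using fin by (simp add: crossing_eq_esym sum.remove[OF fI] algebra_simps)
qed

text \<open>The terms for \<open>V\<close> and for the two classes react to the shift. The
  coefficient linear in \<open>t\<close> is the difference of the partial derivatives of
  \<open>crossing\<close> at \<open>u\<close> and \<open>v\<close>.\<close>

lemma crossing_shift_different:
  fixes x :: "'a \<Rightarrow> real"
  assumes fin: "finite V" and uv: "u \<in> V" "v \<in> V" and c: "c u \<noteq> c v"
  shows "crossing (Suc (Suc s)) V c (x(u := x u + t, v := x v - t)) = crossing (Suc (Suc s)) V c x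
    + (t * (x v - x u) - t\<^sup>2) * esym s (V - {u, v}) x
    - t * esym (Suc s) (colour_class V c (c u) - {u}) x + t * esym (Suc s) (colour_class V c (c v) - {v}) x"
proof -
  let ?y = "x(u := x u + t, v := x v - t)" and ?P = "colour_class V c" and ?r = "Suc (Suc s)"
  have ne: "u \<noteq> v" using c by auto
  have fI: "finite (c ` V)" "c u \<in> c ` V" using fin uv by auto
  have fJ: "finite (c ` V - {c u})" "c v \<in> c ` V - {c u}" using fin uv c by auto
  have "(\<Sum>i\<in>c ` V - {c u} - {c v}. esym ?r (?P i) ?y) = (\<Sum>i\<in>c ` V - {c u} - {c v}. esym ?r (?P i) x)"
    using fin ne by (intro sum.cong refl esym_shift(4)) (auto simp: colour_class_def)
  moreover have "esym ?r (?P (c u)) ?y = esym ?r (?P (c u)) x + t * esym (Suc s) (?P (c u) - {u}) x"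
    using fin uv c ne by (intro esym_shift(2)) (auto simp: colour_class_def)
  moreover have "esym ?r (?P (c v)) ?y = esym ?r (?P (c v)) x - t * esym (Suc s) (?P (c v) - {v}) x"
    using fin uv c ne by (intro esym_shift(3)) (auto simp: colour_class_def)
  moreover have "esym ?r V ?y = esym ?r V x + (t * (x v - x u) - t\<^sup>2) * esym s (V - {u, v}) x"
    using fin uv ne by (intro esym_shift(1)) auto
  ultimately show ?thesis
    using fin by (simp add: crossing_eq_esym sum.remove[OF fI] sum.remove[OF fJ] algebra_simps)
qed

section \<open>Maximizers on the simplex and their first-order conditions\<close>

definition simplex_maximizer :: "nat \<Rightarrow> 'a set \<Rightarrow> ('a \<Rightarrow> 'i) \<Rightarrow> real \<Rightarrow> ('a \<Rightarrow> real) \<Rightarrow> bool" where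
  "simplex_maximizer r V c m x \<longleftrightarrow> (\<forall>v\<in>V. 0 \<le> x v) \<and> sum x V = m \<and>
    (\<forall>y. (\<forall>v\<in>V. 0 \<le> y v) \<longrightarrow> sum y V = m \<longrightarrow> crossing r V c y \<le> crossing r V c x)"

lemma crossing_scale: "crossing r V c (\<lambda>v. m * x v) = m ^ r * crossing r V c x"
  unfolding crossing_def sum_distrib_left
  by (intro sum.cong) (auto simp: crossing_sets_def prod.distrib)

lemma crossing_abs: "crossing r V c x \<le> crossing r V c (\<lambda>v. \<bar>x v\<bar>)"
  unfolding crossing_def by (intro sum_mono) (simp flip: abs_prod)

text \<open>Compactness is inherited from \<open>spectral_radius_is_max\<close> with exponent 1,
  applied to the \<open>r\<close>-graph of crossing sets. Absolute values make the maximizer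
  nonnegative, and homogeneity rescales it to mass \<open>m\<close>.\<close>

lemma simplex_maximizer_exists:
  assumes fin: "finite V" and "V \<noteq> {}" and m: "0 < m"
  shows "\<exists>x. simplex_maximizer r V c m x"
proof -
  let ?E = "crossing_sets r V c"
  have "r_graph r V ?E" using fin by (auto simp: r_graph_def crossing_sets_def)
  from spectral_radius_is_max[OF this \<open>V \<noteq> {}\<close>, of 1]
  obtain x where x: "x \<in> p_sphere 1 V"
    and max: "\<And>y. y \<in> p_sphere 1 V \<Longrightarrow> poly_form r ?E y \<le> poly_form r ?E x" by auto
  have pf: "poly_form r ?E y = fact r * crossing r V c y" for y
    by (simp add: poly_form_def crossing_def)
  have sphere: "y \<in> p_sphere 1 V \<longleftrightarrow> (\<Sum>v\<in>V. \<bar>y v\<bar>) = 1" for y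
    by (simp add: p_sphere_def)
  have "simplex_maximizer r V c m (\<lambda>v. m * \<bar>x v\<bar>)"
    unfolding simplex_maximizer_def
  proof (intro conjI ballI allI impI)
    show "(\<Sum>v\<in>V. m * \<bar>x v\<bar>) = m" using x by (simp add: sphere flip: sum_distrib_left)
  next
    fix y assume y: "\<forall>v\<in>V. 0 \<le> y v" "sum y V = m"
    have "(\<Sum>v\<in>V. \<bar>inverse m * y v\<bar>) = (\<Sum>v\<in>V. inverse m * y v)"
      using y m by (intro sum.cong) auto
    also have "\<dots> = 1" using y m by (simp flip: sum_distrib_left)
    finally have "crossing r V c (\<lambda>v. inverse m * y v) \<le> crossing r V c x"
      using max[of "\<lambda>v. inverse m * y v"] by (simp add: sphere pf)
    also have "\<dots> \<le> crossing r V c (\<lambda>v. \<bar>x v\<bar>)" by (rule crossing_abs)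
    finally have "m ^ r * crossing r V c (\<lambda>v. inverse m * y v) \<le> m ^ r * crossing r V c (\<lambda>v. \<bar>x v\<bar>)"
      using m by (intro mult_left_mono) auto
    moreover have "crossing r V c y = m ^ r * crossing r V c (\<lambda>v. inverse m * y v)"
    proof -
      have "(\<lambda>v. m * (inverse m * y v)) = y" using m by auto
      then show ?thesis using crossing_scale[of r V c m "\<lambda>v. inverse m * y v"] by simp
    qed
    ultimately have "crossing r V c y \<le> m ^ r * crossing r V c (\<lambda>v. \<bar>x v\<bar>)" by linarith
    then show "crossing r V c y \<le> crossing r V c (\<lambda>v. m * \<bar>x v\<bar>)"
      by (simp only: crossing_scale)
  qed (use m in auto)
  then show ?thesis by blast
qed

lemma simplex_maximizer_shift:
  assumes x: "simplex_maximizer r V c m x" and fin: "finite V"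
    and uv: "u \<in> V" "v \<in> V" "u \<noteq> v" and t: "- x u \<le> t" "t \<le> x v"
  shows "crossing r V c (x(u := x u + t, v := x v - t)) \<le> crossing r V c x"
proof -
  let ?y = "x(u := x u + t, v := x v - t)"
  have "\<forall>w\<in>V. 0 \<le> ?y w" using x t by (auto simp: simplex_maximizer_def)
  moreover have "sum ?y V = m"
  proof -
    have V: "V = insert u (insert v (V - {u, v}))" using uv by auto
    have "sum ?y (V - {u, v}) = sum x (V - {u, v})" by (intro sum.cong) auto
    moreover have "sum f V = f u + f v + sum f (V - {u, v})" for f :: "'a \<Rightarrow> real"
      by (subst V) (use fin uv in \<open>simp add: sum.insert_remove insert_Diff_if\<close>)
    ultimately have "sum ?y V = sum x V" using uv by simp
    then show ?thesis using x by (simp add: simplex_maximizer_def)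
  qed
  ultimately show ?thesis using x by (simp add: simplex_maximizer_def)
qed

lemma esym_pos:
  assumes "finite A" "\<And>v. v \<in> A \<Longrightarrow> 0 \<le> x v" "T \<subseteq> A" "\<And>v. v \<in> T \<Longrightarrow> 0 < x v"
  shows "0 < esym (card T) A x"
proof -
  have "0 < (\<Prod>v\<in>T. x v)" using assms by (intro prod_pos) auto
  also have "\<dots> \<le> esym (card T) A x"
    unfolding esym_def using assms
    by (intro member_le_sum[where f = "prod x"]) (auto intro!: prod_nonneg)
  finally show ?thesis .
qed

text \<open>Some crossing set \<open>R\<close> has only positive weights. Deleting \<open>u\<close>
  and \<open>v\<close> leaves \<open>s\<close> of its elements, which gives the first part. For the
  second, an \<open>s\<close>-set through a vertex \<open>w\<close> of \<open>R\<close> with colour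
  other than \<open>i\<close> is a positive term missing from the class; \<open>1 \<le> s\<close>
  leaves room for \<open>w\<close>.\<close>

lemma crossing_pos_imp_esym_pos:
  assumes fin: "finite V" and nn: "\<And>v. v \<in> V \<Longrightarrow> 0 \<le> x v" and s: "1 \<le> s"
    and pos: "0 < crossing (Suc (Suc s)) V c x"
  shows "0 < esym s (V - {u, v}) x"
    and "c u = i \<Longrightarrow> c v = i \<Longrightarrow> esym s (colour_class V c i - {u, v}) x < esym s (V - {u, v}) x"
proof -
  have "\<exists>R\<in>crossing_sets (Suc (Suc s)) V c. 0 < (\<Prod>v\<in>R. x v)"
  proof (rule ccontr)
    assume "\<not> ?thesis"
    then have "crossing (Suc (Suc s)) V c x \<le> 0"
      unfolding crossing_def by (intro sum_nonpos) (auto simp: not_less)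
    then show False using pos by simp
  qed
  then obtain R where R: "R \<subseteq> V" "card R = Suc (Suc s)" "\<And>i. \<not> R \<subseteq> colour_class V c i"
    and Rpos: "0 < (\<Prod>v\<in>R. x v)" by (auto simp: crossing_sets_def)
  have finR: "finite R" using R fin finite_subset by blast
  have xpos: "0 < x w" if "w \<in> R" for w
  proof -
    have "x w \<noteq> 0" using Rpos that finR by (metis less_irrefl prod_zero)
    then show ?thesis using nn R that by (simp add: less_le subset_iff)
  qed
  have "s \<le> card (R - {u, v})"
    using diff_card_le_card_Diff[of "{u, v}" R] R by (cases "u = v") auto
  then obtain T where T: "T \<subseteq> R - {u, v}" "card T = s" by (meson obtain_subset_with_card_n)
  have "0 < esym (card T) (V - {u, v}) x"
  proof (rule esym_pos)
    show "T \<subseteq> V - {u, v}" using T R by auto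
  qed (use fin nn T xpos in auto)
  then show "0 < esym s (V - {u, v}) x" by (simp add: T)
  assume i: "c u = i" "c v = i"
  obtain w where w: "w \<in> R" "c w \<noteq> i" using R(1) R(3)[of i] by (auto simp: colour_class_def)
  have "card {u, v, w} \<le> 3" by (simp add: card_insert_if)
  then have "s - 1 \<le> card (R - {u, v, w})"
    using diff_card_le_card_Diff[of "{u, v, w}" R] R by simp
  then obtain T where T: "T \<subseteq> R - {u, v, w}" "card T = s - 1" by (meson obtain_subset_with_card_n)
  let ?T = "insert w T"
  let ?P = "colour_class V c i - {u, v}"
  have finT: "finite T" using T finR finite_subset by blast
  have cT: "card ?T = s" using T finT s by (subst card_insert_disjoint) auto
  have TV: "?T \<subseteq> V - {u, v}" using T R w i by auto
  have TP: "\<not> ?T \<subseteq> ?P" using w by (auto simp: colour_class_def)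
  have Tpos: "0 < (\<Prod>v\<in>?T. x v)" using T w xpos by (intro prod_pos) auto
  have finP: "finite {S. S \<subseteq> ?P \<and> card S = s}"
    by (rule finite_subset[of _ "Pow V"]) (use fin in \<open>auto simp: colour_class_def\<close>)
  have "esym s ?P x < esym s ?P x + (\<Prod>v\<in>?T. x v)" using Tpos by simp
  also have "\<dots> = (\<Sum>S\<in>insert ?T {S. S \<subseteq> ?P \<and> card S = s}. \<Prod>v\<in>S. x v)"
    using finP TP by (subst sum.insert) (auto simp: esym_def)
  also have "\<dots> \<le> esym s (V - {u, v}) x"
    unfolding esym_def
  proof (rule sum_mono2)
    show "insert ?T {S. S \<subseteq> ?P \<and> card S = s} \<subseteq> {S. S \<subseteq> V - {u, v} \<and> card S = s}"
      using TV cT by (auto simp: colour_class_def)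
  qed (use fin nn in \<open>auto intro!: prod_nonneg\<close>)
  finally show "esym s (colour_class V c i - {u, v}) x < esym s (V - {u, v}) x" .
qed

text \<open>The partial derivative at \<open>v\<close> of the subtracted part of
  \<open>crossing\<close> in degree \<open>Suc q\<close>: only the class of \<open>v\<close>
  contributes. It is the \<open>B\<close> of the numerical inequality.\<close>

definition class_gradient :: "nat \<Rightarrow> 'a set \<Rightarrow> ('a \<Rightarrow> 'i) \<Rightarrow> ('a \<Rightarrow> real) \<Rightarrow> 'a \<Rightarrow> real" where
  "class_gradient q V c x v = esym q (colour_class V c (c v) - {v}) x"

text \<open>All three conditions come from explicit weight shifts between two vertices, under which
  \<open>crossing\<close> is a quadratic polynomial in \<open>t\<close>; no calculus is
  involved.\<close>

lemma simplex_maximizer_stationary: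
  assumes max: "simplex_maximizer (Suc (Suc s)) V c m x" and fin: "finite V" and s: "1 \<le> s"
    and pos: "0 < crossing (Suc (Suc s)) V c x"
  shows "u \<in> V \<Longrightarrow> v \<in> V \<Longrightarrow> c u = c v \<Longrightarrow> x u = x v"
    and "v \<in> V \<Longrightarrow> 0 < x v"
    and "u \<in> V \<Longrightarrow> v \<in> V \<Longrightarrow> (x u - x v) * esym s (V - {u, v}) x =
      class_gradient (Suc s) V c x v - class_gradient (Suc s) V c x u"
proof -
  have nn: "0 \<le> x v" if "v \<in> V" for v using max that by (simp add: simplex_maximizer_def)
  have esym_pos: "0 < esym s (V - {u, v}) x"
    "c u = i \<Longrightarrow> c v = i \<Longrightarrow> esym s (colour_class V c i - {u, v}) x < esym s (V - {u, v}) x" for u v i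
    by (rule crossing_pos_imp_esym_pos[OF fin _ s pos]; (rule nn)?; assumption)+
  have same: "x u = x v" if uv: "u \<in> V" "v \<in> V" "c u = c v" for u v
  proof (cases "u = v")
    case False
    \<comment> \<open>This shift equalizes the two weights and maximizes
      \<open>t * (x v - x u) - t^2\<close>, with value \<open>t^2\<close>.\<close>
    define t where "t = (x v - x u) / 2"
    define \<gamma> where "\<gamma> = esym s (V - {u, v}) x - esym s (colour_class V c (c u) - {u, v}) x"
    have "- x u \<le> t" "t \<le> x v" using nn[OF uv(1)] nn[OF uv(2)] by (auto simp: t_def)
    from simplex_maximizer_shift[OF max fin uv(1,2) False this]
    have "(t * (x v - x u) - t\<^sup>2) * \<gamma> \<le> 0"
      using crossing_shift_same[OF fin uv(1,2) False uv(3)] by (simp add: \<gamma>_def)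
    also have "t * (x v - x u) - t\<^sup>2 = t\<^sup>2" by (simp add: t_def power2_eq_square field_simps)
    finally have "t\<^sup>2 * \<gamma> \<le> 0" .
    moreover have "0 < \<gamma>" unfolding \<gamma>_def using esym_pos(2)[OF refl uv(3)[symmetric]] by simp
    ultimately have "t = 0" by (simp add: mult_le_0_iff)
    then show ?thesis by (simp add: t_def)
  qed simp
  have shift: "t * ((x v - x u) * esym s (V - {u, v}) x - class_gradient (Suc s) V c x u
      + class_gradient (Suc s) V c x v) \<le> t\<^sup>2 * esym s (V - {u, v}) x"
    if uv: "u \<in> V" "v \<in> V" "c u \<noteq> c v" and t: "- x u \<le> t" "t \<le> x v" for u v t
  proof -
    have "u \<noteq> v" using uv by auto
    from simplex_maximizer_shift[OF max fin uv(1,2) this t]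
    show ?thesis
      using crossing_shift_different[OF fin uv, of s x t] by (simp add: class_gradient_def algebra_simps)
  qed
  have xpos: "0 < x u" if u: "u \<in> V" for u
  proof (rule ccontr)
    assume "\<not> 0 < x u"
    then have xu: "x u = 0" using nn[OF u] by simp
    have "\<exists>v\<in>V. 0 < x v"
    proof (rule ccontr)
      assume "\<not> ?thesis"
      then have "x v = 0" if "v \<in> V" for v using nn[OF that] that by force
      moreover have "\<exists>v\<in>S. v \<in> V" "finite S" if S: "S \<in> crossing_sets (Suc (Suc s)) V c" for S
      proof -
        have "S \<subseteq> V" "card S = Suc (Suc s)" using S by (auto simp: crossing_sets_def)
        moreover from this have "S \<noteq> {}" by auto
        ultimately show "\<exists>v\<in>S. v \<in> V" "finite S" using fin finite_subset by blast+
      qed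
      ultimately have "crossing (Suc (Suc s)) V c x = 0"
        unfolding crossing_def by (intro sum.neutral ballI prod_zero) blast+
      then show False using pos by simp
    qed
    then obtain v where v: "v \<in> V" "0 < x v" by blast
    have cuv: "c u \<noteq> c v" using same[OF u v(1)] xu v by auto
    \<comment> \<open>By \<open>same\<close> the whole class of \<open>u\<close> has weight zero, so
      its gradient vanishes and nothing opposes moving weight to \<open>u\<close>.\<close>
    have "esym (Suc s) (colour_class V c (c u) - {u}) x
        = real (card (colour_class V c (c u) - {u}) choose Suc s) * 0 ^ Suc s"
      using fin u same[OF u] xu by (intro esym_const) (auto simp: colour_class_def)
    then have Bu: "class_gradient (Suc s) V c x u = 0" by (simp add: class_gradient_def)
    have Bv: "0 \<le> class_gradient (Suc s) V c x v"
      using nn by (auto simp: class_gradient_def colour_class_def intro!: esym_nonneg)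
    have E: "0 < esym s (V - {u, v}) x" by (rule esym_pos(1))
    \<comment> \<open>Any amount strictly between 0 and \<open>x v\<close> would give a strict
      gain.\<close>
    define t where "t = x v / 2"
    have t: "0 < t" "x v = 2 * t" using v by (auto simp: t_def)
    have "t * (2 * t * esym s (V - {u, v}) x + class_gradient (Suc s) V c x v) \<le> t\<^sup>2 * esym s (V - {u, v}) x"
      using shift[OF u v(1) cuv, of t] xu Bu t by simp
    then have "t * (t * esym s (V - {u, v}) x + class_gradient (Suc s) V c x v) \<le> 0"
      by (simp add: power2_eq_square algebra_simps)
    moreover have "0 < t * (t * esym s (V - {u, v}) x + class_gradient (Suc s) V c x v)"
      using t E Bv by (intro mult_pos_pos add_pos_nonneg) auto
    ultimately show False by simp
  qed
  show "u \<in> V \<Longrightarrow> v \<in> V \<Longrightarrow> c u = c v \<Longrightarrow> x u = x v" by (rule same)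
  show "v \<in> V \<Longrightarrow> 0 < x v" by (rule xpos)
  assume uv: "u \<in> V" "v \<in> V"
  show "(x u - x v) * esym s (V - {u, v}) x = class_gradient (Suc s) V c x v - class_gradient (Suc s) V c x u"
  proof (cases "c u = c v")
    case True
    let ?P = "colour_class V c (c u)"
    have B: "class_gradient (Suc s) V c x w = real ((card ?P - 1) choose Suc s) * x u ^ Suc s"
      if w: "w \<in> ?P" for w
    proof -
      have cw: "c w = c u" "w \<in> V" using w by (auto simp: colour_class_def)
      have "esym (Suc s) (?P - {w}) x = real (card (?P - {w}) choose Suc s) * x u ^ Suc s"
      proof (rule esym_const)
        fix y assume "y \<in> ?P - {w}"
        then have "y \<in> V" "c y = c u" by (auto simp: colour_class_def)
        then show "x y = x u" using same uv(1) by blast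
      qed (use fin in simp)
      then show ?thesis using w fin by (simp add: class_gradient_def cw)
    qed
    have "u \<in> ?P" "v \<in> ?P" using uv True by (auto simp: colour_class_def)
    then show ?thesis using same[OF uv True] by (simp add: B)
  next
    case False
    define K where "K = (x v - x u) * esym s (V - {u, v}) x - class_gradient (Suc s) V c x u
      + class_gradient (Suc s) V c x v"
    define E where "E = esym s (V - {u, v}) x"
    have E: "0 < E" unfolding E_def by (rule esym_pos(1))
    have K: "t * K \<le> t\<^sup>2 * E" if "- x u \<le> t" "t \<le> x v" for t
      using shift[OF uv False that] by (simp add: K_def E_def)
    define d where "d = min (x u) (x v)"
    have d: "0 < d" "d \<le> x u" "d \<le> x v" using xpos uv by (auto simp: d_def)
    have "K = 0"
    proof (rule ccontr)
      assume "K \<noteq> 0"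
      \<comment> \<open>The sign makes the linear term \<open>t * K\<close> positive, the bound
        \<open>d\<close> keeps the weights nonnegative, and the other bound makes the quadratic loss
        at most half of the linear gain.\<close>
      define t where "t = sgn K * min d (\<bar>K\<bar> / (2 * E))"
      have m: "0 < min d (\<bar>K\<bar> / (2 * E))" using d E \<open>K \<noteq> 0\<close> by simp
      have abst: "\<bar>t\<bar> = min d (\<bar>K\<bar> / (2 * E))"
        using m \<open>K \<noteq> 0\<close> by (simp add: t_def abs_mult)
      have "\<bar>t\<bar> \<le> d" using abst by simp
      then have "t * K \<le> t\<^sup>2 * E" using d by (intro K) auto
      moreover have "t * K = \<bar>t\<bar> * \<bar>K\<bar>"
        unfolding abst by (simp add: t_def sgn_if)
      moreover have "t\<^sup>2 * E = \<bar>t\<bar> * (\<bar>t\<bar> * E)" by (simp add: power2_eq_square)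
      ultimately have "\<bar>K\<bar> \<le> \<bar>t\<bar> * E" using m abst by simp
      also have "\<dots> \<le> \<bar>K\<bar> / (2 * E) * E" using abst E by (intro mult_right_mono) auto
      also have "\<dots> = \<bar>K\<bar> / 2" using E by simp
      finally show False using \<open>K \<noteq> 0\<close> by simp
    qed
    then show ?thesis by (simp add: K_def algebra_simps)
  qed
qed

section \<open>The bound for the crossing polynomial\<close>

text \<open>Both \<open>M ^ q\<close> and \<open>falling_ratio q (1 / M)\<close> are nonnegative and
  nondecreasing in \<open>M\<close> from \<open>q\<close> on; below \<open>q\<close> the polynomial
  may oscillate.\<close>

lemma gbinomial_pred_mono:
  assumes "1 \<le> q" "real q \<le> M" "M \<le> M'"
  shows "(M - 1) gchoose q \<le> (M' - 1) gchoose q"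
proof -
  have "M ^ q * falling_ratio q (1 / M) \<le> M' ^ q * falling_ratio q (1 / M')"
    using assms by (intro mult_mono power_mono falling_ratio_antimono falling_ratio_nonneg) (auto simp: frac_le divide_simps)
  then have "fact q * ((M - 1) gchoose q) \<le> fact q * ((M' - 1) gchoose q)"
    using assms by (simp add: gbinomial_pred_eq_falling_ratio)
  then show ?thesis by (simp only: mult_le_cancel_left_pos fact_gt_zero)
qed

text \<open>The power contributes the factor \<open>2 ^ q\<close>, and the falling ratio at
  \<open>1/M\<close> is at most that at \<open>1/n\<close>. Used for \<open>M = n/k\<close>, where
  \<open>2 \<le> k\<close>.\<close>

lemma gbinomial_pred_half:
  assumes "1 \<le> q" "real q \<le> M" "2 * M \<le> real n" "1 \<le> n"
  shows "2 ^ q * ((M - 1) gchoose q) \<le> real ((n - 1) choose q)"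
proof -
  have "M ^ q * falling_ratio q (1 / M) \<le> (real n / 2) ^ q * falling_ratio q (1 / real n)"
    using assms by (intro mult_mono power_mono falling_ratio_antimono falling_ratio_nonneg) (auto simp: frac_le divide_simps)
  then have "2 ^ q * (fact q * ((M - 1) gchoose q)) \<le> fact q * real ((n - 1) choose q)"
    using assms binomial_pred_eq_falling_ratio[of n q] by (simp add: gbinomial_pred_eq_falling_ratio power_divide field_simps)
  then have "fact q * (2 ^ q * ((M - 1) gchoose q)) \<le> fact q * real ((n - 1) choose q)"
    by (simp only: ac_simps)
  then show ?thesis by (simp only: mult_le_cancel_left_pos fact_gt_zero)
qed

section \<open>The extremal value and its dependence on the number of colours\<close>

definition chromatic_bound :: "nat \<Rightarrow> nat \<Rightarrow> nat \<Rightarrow> real" where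
  "chromatic_bound r k n = real (n choose r) - real k * ((real n / real k) gchoose r)"

text \<open>Euler's identity in the ideal case of unit weights and equal classes: the last factor is
  the common partial derivative, extended to non-integral \<open>n/k\<close>.\<close>

lemma chromatic_bound_eq:
  assumes "1 \<le> k" "1 \<le> n"
  shows "real (Suc q) * chromatic_bound (Suc q) k n =
    real n * (real ((n - 1) choose q) - ((real n / real k - 1) gchoose q))"
proof -
  have "Suc q * (n choose Suc q) = n * ((n - 1) choose q)" by (rule binomial_absorption)
  then have "real (Suc q) * real (n choose Suc q) = real n * real ((n - 1) choose q)"
    by (metis of_nat_mult)
  moreover have "real k * (real (Suc q) * ((real n / real k) gchoose Suc q)) = real n * ((real n / real k - 1) gchoose q)"
    using assms by (simp only: Suc_times_gbinomial) simp
  ultimately show ?thesis by (simp add: chromatic_bound_def algebra_simps del: of_nat_Suc)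
qed

lemma chromatic_bound_nonneg:
  assumes "1 \<le> q" "1 \<le> k" "q * k < n"
  shows "0 \<le> chromatic_bound (Suc q) k n"
proof -
  have "real q * real k \<le> real n" using assms by (metis less_imp_le of_nat_le_iff of_nat_mult)
  then have "real q \<le> real n / real k" using assms by (simp add: field_simps)
  moreover have "real n / real k \<le> real n" using assms by (simp add: field_simps)
  ultimately have "(real n / real k - 1) gchoose q \<le> (real n - 1) gchoose q"
    using assms by (intro gbinomial_pred_mono)
  also have "\<dots> = real ((n - 1) choose q)" using assms by (simp add: binomial_gbinomial of_nat_diff)
  finally have "0 \<le> real (Suc q) * chromatic_bound (Suc q) k n"
    using assms by (simp add: chromatic_bound_eq del: of_nat_Suc)
  then show ?thesis by (simp add: zero_le_mult_iff del: of_nat_Suc)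
qed

text \<open>Covers colourings that use fewer than \<open>k\<close> colours.\<close>

lemma chromatic_bound_mono:
  assumes "1 \<le> q" "1 \<le> k'" "k' \<le> k" "q * k < n"
  shows "chromatic_bound (Suc q) k' n \<le> chromatic_bound (Suc q) k n"
proof -
  have "real q * real k \<le> real n" using assms by (metis less_imp_le of_nat_le_iff of_nat_mult)
  then have "real q \<le> real n / real k" using assms by (simp add: field_simps)
  moreover have "real n / real k \<le> real n / real k'" using assms by (intro divide_left_mono) auto
  ultimately have "(real n / real k - 1) gchoose q \<le> (real n / real k' - 1) gchoose q"
    using assms by (intro gbinomial_pred_mono)
  then have "real (Suc q) * chromatic_bound (Suc q) k' n \<le> real (Suc q) * chromatic_bound (Suc q) k n"
    using assms by (simp add: chromatic_bound_eq mult_left_mono del: of_nat_Suc)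
  then show ?thesis by (simp only: mult_le_cancel_left_pos of_nat_0_less_iff zero_less_Suc)
qed

text \<open>The numerical inequality behind \<open>esym_gap\<close>. For \<open>q \<ge> 4\<close> it
  is a product of separate bounds joined by the constant 4. For \<open>q = 3\<close> the bound
  \<open>pow\<close> fails, as 48 exceeds 35, and \<open>N \<ge> 7\<close> is used directly.\<close>

lemma gap_polynomial:
  fixes Q N :: real
  assumes q: "3 \<le> q" and Q: "Q = real q" and N: "2 * Q + 1 \<le> N"
  shows "Q * (Q + 1) * N * (2 * N - 3 - Q) \<le> (2 ^ q - 1) * (Q + 2) * (N - Q) * (N - 2)"
proof (cases "q = 3")
  case True
  have "7 \<le> N" using N Q True by simp
  then have "12 * N * 2 * (N - 3) \<le> 35 * (N - 2) * (N - 3)"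
    by (intro mult_right_mono) auto
  then show ?thesis using Q True by (simp add: algebra_simps)
next
  case False
  then have "4 \<le> q" using q by simp
  then have pow: "4 * (Q + 1) * Q \<le> (2 ^ q - 1) * (Q + 2)"
    unfolding Q
  proof (induction q rule: dec_induct)
    case (step q)
    have q4: "4 \<le> real q" using step by simp
    have "4 * (real q + 1) * real q \<le> (2 ^ q - 1) * (real q + 2)" by (rule step.IH)
    moreover have "4 * (real q + 2) * (real q + 1) * (real q + 2)
      \<le> 2 * (4 * (real q + 1) * real q) * (real q + 3)"
    proof -
      have "(real q + 1) * ((real q + 2) * (real q + 2)) \<le> (real q + 1) * (2 * real q * (real q + 3))"
      proof (intro mult_left_mono)
        have "4 * real q \<le> real q * real q" using q4 by (intro mult_right_mono) auto
        then show "(real q + 2) * (real q + 2) \<le> 2 * real q * (real q + 3)"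
          using q4 mult_mono[of 4 "real q" 4 "real q"] by (simp add: algebra_simps)
      qed (use q4 in auto)
      then show ?thesis by (simp add: algebra_simps)
    qed
    moreover have "2 * (4 * (real q + 1) * real q) * (real q + 3) \<le> 2 * ((2 ^ q - 1) * (real q + 2)) * (real q + 3)"
      using step.IH q4 by (intro mult_left_mono mult_right_mono) auto
    ultimately have "(4 * (real q + 2) * (real q + 1)) * (real q + 2) \<le> (2 * (2 ^ q - 1) * (real q + 3)) * (real q + 2)"
      by (simp add: algebra_simps)
    then have "4 * (real q + 2) * (real q + 1) \<le> 2 * (2 ^ q - 1) * (real q + 3)"
      using q4 by (simp only: mult_le_cancel_right_pos)
    also have "\<dots> \<le> (2 ^ Suc q - 1) * (real q + 3)" by (intro mult_right_mono) auto
    finally show ?case by (simp add: algebra_simps)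
  qed simp
  have Q4: "4 \<le> Q" using Q \<open>4 \<le> q\<close> by simp
  have "N * (2 * N - 3 - Q) \<le> (2 * (N - Q)) * (2 * (N - 2))"
    using N Q4 by (intro mult_mono) auto
  then have "(Q * (Q + 1)) * (N * (2 * N - 3 - Q)) \<le> (Q * (Q + 1)) * ((2 * (N - Q)) * (2 * (N - 2)))"
    using Q4 by (intro mult_left_mono) auto
  also have "\<dots> = (4 * (Q + 1) * Q) * ((N - Q) * (N - 2))" by (simp add: algebra_simps)
  also have "\<dots> \<le> ((2 ^ q - 1) * (Q + 2)) * ((N - Q) * (N - 2))"
    using pow N Q4 by (intro mult_right_mono) auto
  finally show ?thesis by (simp add: algebra_simps)
qed

text \<open>The constant on the left is the \<open>L\<close> of \<open>weighted_sum_lower_bound\<close>. The hypothesis on \<open>x v\<close>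
  holds when at least \<open>q + 1\<close> vertices other than \<open>u\<close> have weight \<open>x v\<close>.\<close>

lemma esym_gap:
  fixes x :: "'a \<Rightarrow> real"
  assumes fin: "finite V" and n: "card V = n" and q: "3 \<le> q" and k: "2 \<le> k" and nq: "q * k < n"
    and nn: "\<And>v. v \<in> V \<Longrightarrow> 0 \<le> x v" and sum: "sum x V = real n"
    and uv: "u \<in> V" "v \<in> V" "u \<noteq> v" and le: "x v \<le> x u" and small: "(real q + 2) * x v \<le> real n"
    and big: "real ((n - 1) choose q) - ((real n / real k - 1) gchoose q) < esym q (V - {u}) x"
  shows "real q * real (Suc q) / 2 * falling_ratio (q - 1) (1 / real n) * (real n / 2) ^ (q - 1)
    < fact q * esym (q - 1) (V - {u, v}) x"
proof -
  define E where "E = esym (q - 1) (V - {u, v}) x"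
  define Q where "Q = real q"
  define N where "N = real n"
  define p where "p = falling_ratio (q - 1) (1 / N)"
  have q2: "2 * q < n" using k nq by (metis le_less_trans mult.commute mult_le_mono1)
  have NQ: "2 * Q + 1 \<le> N" using q2 by (simp add: N_def Q_def)
  have Q3: "3 \<le> Q" using q by (simp add: Q_def)
  have N0: "0 < N" using NQ Q3 by linarith
  have E0: "0 \<le> E" unfolding E_def using nn by (intro esym_nonneg) auto
  have p0: "0 < p"
    unfolding p_def falling_ratio_def
  proof (intro prod_pos)
    fix j assume "j \<in> {1..q - 1}"
    then have "j \<le> q - 1" by simp
    then have "j < n" using q2 by linarith
    then have "real j < N" by (simp add: N_def)
    then show "0 < 1 - real j * (1 / N)" using N0 by simp
  qed
  have sq: "Suc (q - 1) = q" using q by simp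
  have V: "V - {u} - {v} = V - {u, v}" by auto
  have card: "card (V - {u, v}) = n - 2" using fin uv n by (simp add: card_Diff_subset)
  then have cardN: "real (card (V - {u, v})) = N - 2" using q2 q by (simp add: N_def)
  have sumW: "sum x (V - {u, v}) = N - x u - x v"
  proof -
    have "V = insert u (insert v (V - {u, v}))" using uv by auto
    then have "sum x V = x u + x v + sum x (V - {u, v})"
      using fin uv by (metis (no_types, lifting) DiffD2 Diff_insert_absorb add.assoc finite_Diff finite_insert insertCI insert_iff sum.insert)
    then show ?thesis using sum by (simp add: N_def)
  qed
  \<comment> \<open>A single Maclaurin step on the remaining vertices bounds \<open>esym q\<close>
    by \<open>E\<close>, so a lower bound on the derivative at \<open>u\<close> turns into one on
    \<open>E\<close>.\<close>
  have "real (card (V - {u, v})) * (real (Suc (q - 1)) * esym (Suc (q - 1)) (V - {u, v}) x)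
      \<le> (real (card (V - {u, v})) - real (q - 1)) * (sum x (V - {u, v}) * esym (q - 1) (V - {u, v}) x)"
    using fin nn by (intro esym_Suc_le) auto
  then have 1: "(N - 2) * (Q * esym q (V - {u, v}) x) \<le> (N - 1 - Q) * ((N - x u - x v) * E)"
    using q unfolding cardN sumW sq by (simp add: Q_def E_def of_nat_diff algebra_simps)
  have 2: "esym q (V - {u}) x = esym q (V - {u, v}) x + x v * E"
    using esym_remove[of "V - {u}" v "q - 1" x] fin uv unfolding sq V E_def by simp
  have "(N - 1 - Q) * (N - x u - x v) + (N - 2) * Q * x v \<le> N * (N - 1 - Q) + x v * (Q * N - 2 * N + 2)"
  proof -
    have "(N - 1 - Q) * (N - x u - x v) \<le> (N - 1 - Q) * (N - 2 * x v)"
      using NQ Q3 le by (intro mult_left_mono) auto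
    then show ?thesis by (simp add: algebra_simps)
  qed
  \<comment> \<open>The preceding bound grows with \<open>x v\<close>, and \<open>small\<close>
    allows at most \<open>x v = N / (Q + 2)\<close>.\<close>
  moreover have "(Q + 2) * x v * (Q * N - 2 * N + 2) \<le> N * (Q * N - 2 * N + 2)"
  proof (intro mult_right_mono)
    show "(Q + 2) * x v \<le> N" using small by (simp add: Q_def N_def)
    have "2 * N \<le> Q * N" using Q3 N0 by (intro mult_right_mono) auto
    then show "0 \<le> Q * N - 2 * N + 2" by simp
  qed
  ultimately have bracket: "(Q + 2) * ((N - 1 - Q) * (N - x u - x v) + (N - 2) * Q * x v)
      \<le> N * Q * (2 * N - 3 - Q)"
  proof -
    assume a: "(N - 1 - Q) * (N - x u - x v) + (N - 2) * Q * x v \<le> N * (N - 1 - Q) + x v * (Q * N - 2 * N + 2)"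
      and b: "(Q + 2) * x v * (Q * N - 2 * N + 2) \<le> N * (Q * N - 2 * N + 2)"
    have "(Q + 2) * ((N - 1 - Q) * (N - x u - x v) + (N - 2) * Q * x v)
        \<le> (Q + 2) * (N * (N - 1 - Q) + x v * (Q * N - 2 * N + 2))"
      using a Q3 by (intro mult_left_mono) auto
    also have "\<dots> = (Q + 2) * (N * (N - 1 - Q)) + (Q + 2) * x v * (Q * N - 2 * N + 2)"
      by (simp add: algebra_simps)
    also have "\<dots> \<le> (Q + 2) * (N * (N - 1 - Q)) + N * (Q * N - 2 * N + 2)" using b by simp
    also have "\<dots> = N * Q * (2 * N - 3 - Q)" by (simp add: algebra_simps)
    finally show ?thesis .
  qed
  have "(N - 2) * Q * esym q (V - {u}) x \<le> ((N - 1 - Q) * (N - x u - x v) + (N - 2) * Q * x v) * E"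
    using 1 by (simp add: 2 algebra_simps)
  then have "(Q + 2) * ((N - 2) * Q * esym q (V - {u}) x)
      \<le> (Q + 2) * (((N - 1 - Q) * (N - x u - x v) + (N - 2) * Q * x v) * E)"
    using Q3 by (intro mult_left_mono) auto
  also have "\<dots> = ((Q + 2) * ((N - 1 - Q) * (N - x u - x v) + (N - 2) * Q * x v)) * E"
    by (simp only: mult.assoc)
  also have "\<dots> \<le> N * Q * (2 * N - 3 - Q) * E" using bracket E0 by (rule mult_right_mono)
  finally have "Q * ((Q + 2) * (N - 2) * esym q (V - {u}) x) \<le> Q * (N * (2 * N - 3 - Q) * E)"
    by (simp add: algebra_simps)
  then have upper: "(Q + 2) * (N - 2) * esym q (V - {u}) x \<le> N * (2 * N - 3 - Q) * E"
    using Q3 by (simp only: mult_le_cancel_left_pos)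
  \<comment> \<open>Since the subtracted binomial is at most a fraction \<open>1 / 2 ^ q\<close> of
    the first one, \<open>big\<close> retains the fraction \<open>1 - 1 / 2 ^ q\<close> of
    it.\<close>
  have lower: "(2 ^ q - 1) * (N ^ (q - 1) * p * (N - Q)) < 2 ^ q * (fact q * esym q (V - {u}) x)"
  proof -
    have "real q * real k \<le> real n" using nq by (metis less_imp_le of_nat_le_iff of_nat_mult)
    then have "real q \<le> real n / real k" using k by (simp add: field_simps)
    moreover have "2 * (real n / real k) \<le> real n"
      using k mult_right_mono[of 2 "real k" "real n"] by (simp add: field_simps)
    ultimately have "2 ^ q * ((real n / real k - 1) gchoose q) \<le> real ((n - 1) choose q)"
      using q q2 by (intro gbinomial_pred_half) auto
    moreover have "2 ^ q * (real ((n - 1) choose q) - ((real n / real k - 1) gchoose q)) < 2 ^ q * esym q (V - {u}) x"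
      using big by simp
    ultimately have "(2 ^ q - 1) * real ((n - 1) choose q) < 2 ^ q * esym q (V - {u}) x"
      by (simp add: algebra_simps)
    then have "fact q * ((2 ^ q - 1) * real ((n - 1) choose q)) < fact q * (2 ^ q * esym q (V - {u}) x)"
      by (simp only: mult_less_cancel_left_pos fact_gt_zero)
    moreover have "fact q * real ((n - 1) choose q) = N ^ (q - 1) * p * (N - Q)"
    proof -
      obtain s where s: "q = Suc s" using q by (cases q) auto
      have "fact q * real ((n - 1) choose q) = N ^ q * falling_ratio q (1 / N)"
        using binomial_pred_eq_falling_ratio[of n q] q2 by (simp add: N_def)
      also have "\<dots> = N ^ (q - 1) * p * (N - Q)"
        using N0 by (simp add: s falling_ratio_Suc p_def Q_def field_simps)
      finally show ?thesis .
    qed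
    ultimately show ?thesis by (metis (no_types, lifting) mult.left_commute)
  qed
  have pos1: "0 < N * (2 * N - 3 - Q)" using N0 NQ Q3 by simp
  have c0: "0 < N ^ (q - 1) * p" using N0 p0 by simp
  have "(Q * (Q + 1) * N * (2 * N - 3 - Q)) * (N ^ (q - 1) * p)
      \<le> ((2 ^ q - 1) * (Q + 2) * (N - Q) * (N - 2)) * (N ^ (q - 1) * p)"
    using gap_polynomial[OF q Q_def NQ] c0 by (intro mult_right_mono) auto
  also have "\<dots> = ((Q + 2) * (N - 2)) * ((2 ^ q - 1) * (N ^ (q - 1) * p * (N - Q)))"
    by (simp only: ac_simps)
  also have "\<dots> < ((Q + 2) * (N - 2)) * (2 ^ q * (fact q * esym q (V - {u}) x))"
    using lower NQ Q3 by (intro mult_strict_left_mono) auto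
  also have "\<dots> = (2 ^ q * fact q) * ((Q + 2) * (N - 2) * esym q (V - {u}) x)"
    by (simp only: ac_simps)
  also have "\<dots> \<le> (2 ^ q * fact q) * (N * (2 * N - 3 - Q) * E)"
    using upper by (intro mult_left_mono) auto
  finally have "(N * (2 * N - 3 - Q)) * (Q * (Q + 1) * (N ^ (q - 1) * p)) < (N * (2 * N - 3 - Q)) * (2 ^ q * (fact q * E))"
    by (simp only: ac_simps)
  then have "Q * (Q + 1) * (N ^ (q - 1) * p) < 2 ^ q * (fact q * E)"
    using pos1 by (simp only: mult_less_cancel_left_pos)
  \<comment> \<open>One factor 2 accounts for the division by 2 and the others for the power of
    \<open>n / 2\<close> in the claim.\<close>
  moreover have "(2::real) ^ q = 2 * 2 ^ (q - 1)" using q by (cases q) auto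
  ultimately show ?thesis
    by (simp add: power_divide field_simps E_def N_def p_def Q_def)
qed

lemma crossing_le_chromatic_bound:
  fixes x :: "'a \<Rightarrow> real" and c :: "'a \<Rightarrow> 'i"
  assumes fin: "finite V" and n: "card V = n" and r: "4 \<le> r" and k: "card (c ` V) = k"
    and k2: "2 \<le> k" and nr: "(r - 1) * k < n"
    and nn: "\<And>v. v \<in> V \<Longrightarrow> 0 \<le> x v" and sum: "sum x V = real n"
  shows "crossing r V c x \<le> chromatic_bound r k n"
proof (rule ccontr)
  define s where "s = r - 2"
  define q where "q = Suc s"
  have rs: "r = Suc q" "q = Suc s" "2 \<le> s" "r = Suc (Suc s)" "r - 1 = q" "3 \<le> q" "1 \<le> q" "1 \<le> s" "q - 1 = s"
    using r by (auto simp: s_def q_def)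
  have nq: "q * k < n" using nr rs by simp
  have n1: "1 \<le> n" using nq by simp
  have V0: "V \<noteq> {}" using n n1 by auto
  assume "\<not> crossing r V c x \<le> chromatic_bound r k n"
  then have Fx: "chromatic_bound r k n < crossing r V c x" by simp
  obtain z where max: "simplex_maximizer r V c (real n) z"
    using simplex_maximizer_exists[OF fin V0, of "real n" r c] n1 by auto
  have z0: "\<And>v. v \<in> V \<Longrightarrow> 0 \<le> z v" and zsum: "sum z V = real n" using max by (auto simp: simplex_maximizer_def)
  have F: "chromatic_bound r k n < crossing r V c z"
  proof -
    have "crossing r V c x \<le> crossing r V c z" using max nn sum by (simp add: simplex_maximizer_def)
    then show ?thesis using Fx by simp
  qed
  have pos: "0 < crossing r V c z"
    using F chromatic_bound_nonneg[of q k n] nq k2 rs by simp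
  note stat = simplex_maximizer_stationary[OF max[unfolded rs(4)] fin rs(8) pos[unfolded rs(4)], folded rs(2)]
  define b where "b = class_gradient q V c z"
  define F where "F = crossing r V c z"
  \<comment> \<open>\<open>g u\<close> is the partial derivative of \<open>crossing\<close> at
    \<open>u\<close>.\<close>
  define g where "g = (\<lambda>u. esym q (V - {u}) z - b u)"
  define P where "P = colour_class V c"
  have finP: "finite (P i)" for i using fin by (simp add: P_def)
  have g_const: "g u = g v" if uv: "u \<in> V" "v \<in> V" for u v
  proof (cases "u = v")
    case False
    have "(z v - z u) * esym s (V - {u, v}) z = b u - b v"
      using stat(3)[OF uv] by (simp add: b_def algebra_simps)
    then show ?thesis
      using esym_remove_diff[OF fin uv False, of s z] by (simp add: g_def rs(2))
  qed simp
  have split: "(\<Sum>v\<in>V. f v) = (\<Sum>i\<in>c ` V. \<Sum>v\<in>P i. f v)" for f :: "'a \<Rightarrow> real"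
    using sum.group[OF fin finite_imageI[OF fin, of c] subset_refl, of f] by (simp add: P_def colour_class_def)
  have euler: "real r * F = (\<Sum>v\<in>V. z v * g v)"
  proof -
    have "(\<Sum>v\<in>V. z v * b v) = (\<Sum>i\<in>c ` V. \<Sum>v\<in>P i. z v * esym q (P i - {v}) z)"
      unfolding split by (intro sum.cong refl) (auto simp: b_def class_gradient_def P_def colour_class_def)
    also have "\<dots> = (\<Sum>i\<in>c ` V. real (Suc q) * esym (Suc q) (P i) z)"
      by (intro sum.cong refl sum_mult_esym_remove finP)
    finally show ?thesis
      using sum_mult_esym_remove[OF fin, of z q] crossing_eq_esym[OF fin, of r c z] rs
      by (simp add: F_def g_def P_def right_diff_distrib sum_subtractf sum_distrib_left del: of_nat_Suc)
  qed
  \<comment> \<open>Euler's identity with total weight \<open>n\<close> determines the common value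
    of the partial derivatives.\<close>
  have gF: "real n * g u = real r * F" if u: "u \<in> V" for u
  proof -
    have "(\<Sum>v\<in>V. z v * g v) = (\<Sum>v\<in>V. z v * g u)"
    proof (intro sum.cong refl)
      fix v assume "v \<in> V"
      then have "g v = g u" using u by (rule g_const)
      then show "z v * g v = z v * g u" by simp
    qed
    then show ?thesis using euler zsum by (simp flip: sum_distrib_right)
  qed
  have b0: "0 \<le> b u" for u
    using z0 by (auto simp: b_def class_gradient_def colour_class_def intro!: esym_nonneg)
  \<comment> \<open>By \<open>chromatic_bound_eq\<close> the assumed excess of \<open>F\<close> is
    an excess of \<open>g u\<close>, and \<open>esym q (V - {u}) z\<close> exceeds
    \<open>g u\<close> by the nonnegative \<open>b u\<close>.\<close>
  have big: "real ((n - 1) choose q) - ((real n / real k - 1) gchoose q) < esym q (V - {u}) z" if u: "u \<in> V" for u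
  proof -
    have "real r * chromatic_bound r k n < real r * F" using F r by (simp add: F_def)
    then have "real n * (real ((n - 1) choose q) - ((real n / real k - 1) gchoose q)) < real n * g u"
      using gF[OF u] k2 n1 by (simp add: rs(1) chromatic_bound_eq del: of_nat_Suc)
    then have "real ((n - 1) choose q) - ((real n / real k - 1) gchoose q) < g u" using n1 by simp
    then show ?thesis using b0[of u] by (simp add: g_def)
  qed
  define I where "I = c ` V"
  define rep where "rep = (\<lambda>i. SOME v. v \<in> V \<and> c v = i)"
  have rep: "rep i \<in> V" "c (rep i) = i" if "i \<in> I" for i
    using someI_ex[of "\<lambda>v. v \<in> V \<and> c v = i"] that by (auto simp: rep_def I_def)
  define a where "a = (\<lambda>i. z (rep i))"
  define N where "N = (\<lambda>i. card (P i))"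
  define B where "B = (\<lambda>i. b (rep i))"
  have za: "z v = a (c v)" if "v \<in> V" for v
    using stat(1)[of v "rep (c v)"] rep[of "c v"] that by (simp add: a_def I_def)
  have repP: "rep i \<in> P i" if "i \<in> I" for i using rep[OF that] by (simp add: P_def colour_class_def)
  have N1: "1 \<le> N i" if "i \<in> I" for i
    using repP[OF that] finP[of i] by (auto simp: N_def Suc_le_eq card_gt_0_iff)
  have bB: "b v = real ((N (c v) - 1) choose q) * a (c v) ^ q" if v: "v \<in> V" for v
  proof -
    have "esym q (P (c v) - {v}) z = real (card (P (c v) - {v}) choose q) * a (c v) ^ q"
      using fin by (intro esym_const) (auto simp: P_def colour_class_def za)
    then show ?thesis using v finP[of "c v"]
      by (simp add: b_def class_gradient_def N_def P_def colour_class_def)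
  qed
  have B: "B i = real ((N i - 1) choose q) * a i ^ q" if "i \<in> I" for i
    using bB[of "rep i"] rep[OF that] by (simp add: B_def)
  have bB': "b v = B (c v)" if "v \<in> V" for v using bB[OF that] B[of "c v"] that by (simp add: I_def)
  have sumNf: "(\<Sum>v\<in>V. f (c v)) = (\<Sum>i\<in>I. real (N i) * f i)" for f :: "'i \<Rightarrow> real"
    unfolding split I_def by (intro sum.cong refl) (simp add: P_def N_def colour_class_def)
  have sumNa: "(\<Sum>i\<in>I. real (N i) * a i) = real n"
    using zsum za by (simp flip: sumNf)
  have sumN: "(\<Sum>i\<in>I. N i) = n"
    using sumNf[of "\<lambda>_. 1"] n by (simp flip: of_nat_sum)
  have rel: "(a i - a j) * esym s (V - {rep i, rep j}) z = B j - B i" if "i \<in> I" "j \<in> I" for i j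
    using stat(3)[of "rep i" "rep j"] rep[OF that(1)] rep[OF that(2)] by (simp add: a_def B_def b_def)
  have key: "real (Suc q) * (real (card I) * ((real n / real (card I)) gchoose Suc q)) \<le> (\<Sum>i\<in>I. real (N i) * B i)"
  proof (rule weighted_sum_lower_bound[OF _ _ _ rs(7) N1 _ sumN sumNa B _ refl])
    show "finite I" "2 \<le> card I" "q * card I < n" using fin k k2 nq by (auto simp: I_def)
    show "0 < a i" if "i \<in> I" for i using stat(2) rep[OF that] by (simp add: a_def)
    show "B i = B j" if "i \<in> I" "j \<in> I" "a i = a j" for i j using rel[of i j] that by simp
    fix i j assume ij: "i \<in> I" "j \<in> I" and aij: "a j < a i"
    let ?u = "rep i" and ?v = "rep j"
    have uv: "?u \<in> V" "?v \<in> V" "?u \<noteq> ?v" using rep ij aij by (auto simp: a_def)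
    have "0 < esym s (V - {?u, ?v}) z"
      using z0 by (intro crossing_pos_imp_esym_pos(1)[OF fin _ rs(8) pos[unfolded rs(4)]])
    \<comment> \<open>Stationarity forces \<open>B j\<close> to be positive, so the lighter class
      has at least \<open>q + 1\<close> vertices.\<close>
    then have "0 < (a i - a j) * esym s (V - {?u, ?v}) z" using aij by simp
    then have "0 < B j" using rel[OF ij] B[OF ij(1)] stat(2)[OF uv(1)]
      by (simp add: a_def) (smt (verit) of_nat_0_le_iff mult_nonneg_nonneg zero_le_power)
    then have "(N j - 1) choose q \<noteq> 0" using B[OF ij(2)] by (metis less_irrefl mult_zero_left of_nat_0)
    then have "q \<le> N j - 1" by (meson binomial_eq_0 not_le)
    then have Nj: "q + 1 \<le> N j" using N1[OF ij(2)] by simp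
    \<comment> \<open>Together with one vertex of the heavier class this gives \<open>q + 2\<close>
      vertices of weight at least \<open>a j\<close> within total mass \<open>n\<close>.\<close>
    have "(real q + 2) * a j \<le> a i + real (N j) * a j"
    proof -
      have "(real q + 1) * a j \<le> real (N j) * a j"
        using Nj stat(2)[OF uv(2)] by (intro mult_right_mono) (auto simp: a_def)
      then show ?thesis using aij by (simp add: algebra_simps)
    qed
    also have "\<dots> \<le> real (N i) * a i + real (N j) * a j"
      using N1[OF ij(1)] stat(2)[OF uv(1)] by (simp add: a_def)
    also have "\<dots> = (\<Sum>l\<in>{i, j}. real (N l) * a l)" using aij by (subst sum.insert) auto
    also have "\<dots> \<le> (\<Sum>l\<in>I. real (N l) * a l)"
    proof (intro sum_mono2)
      show "0 \<le> real (N l) * a l" if "l \<in> I - {i, j}" for l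
        using stat(2)[OF rep(1)[of l]] that by (simp add: a_def)
    qed (use ij fin in \<open>auto simp: I_def\<close>)
    finally have small: "(real q + 2) * z ?v \<le> real n" using sumNa by (simp add: a_def)
    have "real q * real (Suc q) / 2 * falling_ratio (q - 1) (1 / real n) * (real n / 2) ^ (q - 1)
        < fact q * esym (q - 1) (V - {?u, ?v}) z" (is "?L < _")
      using aij z0 by (intro esym_gap[OF fin n rs(6) k2 nq _ zsum uv _ small big[OF uv(1)]]) (auto simp: a_def)
    then have "?L * (a i - a j) < fact q * esym (q - 1) (V - {?u, ?v}) z * (a i - a j)"
      using aij by (intro mult_strict_right_mono) auto
    then show "?L * (a i - a j) < fact q * (B j - B i)"
      unfolding rel[OF ij, symmetric] rs(9) by (simp only: ac_simps)
  qed
  \<comment> \<open>The constant derivative is now averaged with equal vertex weights in place of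
    \<open>z\<close>. This leaves \<open>esym q V z\<close>, to which Maclaurin's inequality
    applies, and the sum bounded in \<open>key\<close>.\<close>
  have "real n * (real r * F) = (\<Sum>u\<in>V. real n * g u)"
    using gF n by simp
  also have "\<dots> = real n * ((\<Sum>u\<in>V. esym q (V - {u}) z) - (\<Sum>u\<in>V. b u))"
    by (simp add: g_def sum_subtractf flip: sum_distrib_left)
  finally have "real r * F = (\<Sum>u\<in>V. esym q (V - {u}) z) - (\<Sum>u\<in>V. b u)" using n1 by simp
  also have "(\<Sum>u\<in>V. b u) = (\<Sum>i\<in>I. real (N i) * B i)"
    unfolding sumNf[symmetric] by (intro sum.cong refl bB')
  also have "(\<Sum>u\<in>V. esym q (V - {u}) z) = (real n - real q) * esym q V z"
    using sum_esym_remove[OF fin, of q z] n by simp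
  also have "\<dots> \<le> (real n - real q) * real (n choose q)"
  proof (intro mult_left_mono)
    have "q \<le> q * k" using k2 by simp
    then have qn: "q \<le> n" using nq by linarith
    then show "esym q V z \<le> real (n choose q)" using esym_le_binomial[of V z q] fin z0 zsum n by simp
    show "0 \<le> real n - real q" using qn by simp
  qed
  also have "\<dots> = real (Suc q) * real (n choose Suc q)"
  proof -
    have "q \<le> q * k" using k2 by simp
    then have qn: "q \<le> n" using nq by linarith
    have "(n - q) * (n choose q) = Suc q * (n choose Suc q)"
      by (simp only: binomial_absorb_comp binomial_absorption)
    then have "real (n - q) * real (n choose q) = real (Suc q) * real (n choose Suc q)" by (metis of_nat_mult)
    then show ?thesis using qn by (simp add: of_nat_diff)
  qed
  finally have "real r * F \<le> real r * chromatic_bound r k n"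
    using key by (simp add: I_def k rs(1) chromatic_bound_def right_diff_distrib del: of_nat_Suc)
  then show False using F r by (simp add: F_def)
qed

section \<open>Power means and the spectral radius\<close>

text \<open>Bernoulli's inequality for real exponents, from Young's inequality for
  \<open>t powr p\<close> and 1 with weights \<open>1 / p\<close> and
  \<open>1 - 1 / p\<close>.\<close>

lemma powr_Bernoulli:
  fixes t p :: real
  assumes "0 \<le> t" "1 \<le> p"
  shows "1 + p * (t - 1) \<le> t powr p"
proof (cases "t = 0")
  case False
  define a where "a = 1 / p"
  have "(t powr p) powr a * 1 powr (1 - a) \<le> a * (t powr p) + (1 - a) * 1"
    using assms False by (intro Youngs_inequality_0) (auto simp: a_def)
  then have "t \<le> t powr p / p + 1 - 1 / p"
    using assms False by (simp add: a_def powr_powr)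
  then have "p * t \<le> p * (t powr p / p + 1 - 1 / p)"
    using assms by (intro mult_left_mono) auto
  then show ?thesis using assms by (simp add: algebra_simps)
qed (use assms in auto)

text \<open>The power mean inequality: Bernoulli's inequality is summed over \<open>z v / m\<close>,
  where the linear terms cancel because these numbers have mean 1.\<close>

lemma mean_le_powr:
  fixes z :: "'a \<Rightarrow> real"
  assumes fin: "finite V" and n: "card V = n" "1 \<le> n" and p: "1 \<le> p"
    and nn: "\<And>v. v \<in> V \<Longrightarrow> 0 \<le> z v" and sum: "(\<Sum>v\<in>V. z v powr p) = 1"
  shows "sum z V / real n \<le> real n powr (- (1 / p))"
proof (cases "sum z V = 0")
  case False
  define m where "m = sum z V / real n"
  have m: "0 < m" using False nn n by (auto simp: m_def less_le intro!: sum_nonneg divide_nonneg_nonneg)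
  have "(\<Sum>v\<in>V. z v / m) = sum z V / m" by (simp add: sum_divide_distrib)
  then have "(\<Sum>v\<in>V. z v / m) = real n" using False by (simp add: m_def)
  then have "real n = (\<Sum>v\<in>V. 1 + p * (z v / m - 1))"
    using n by (simp add: sum.distrib sum_subtractf flip: sum_distrib_left)
  also have "\<dots> \<le> (\<Sum>v\<in>V. (z v / m) powr p)"
    using nn m p by (intro sum_mono powr_Bernoulli) auto
  also have "\<dots> = (\<Sum>v\<in>V. z v powr p / m powr p)"
    using nn m by (intro sum.cong) (auto simp: powr_divide)
  also have "\<dots> = 1 / m powr p" by (simp add: sum flip: sum_divide_distrib)
  finally have "m powr p \<le> 1 / real n" using m n by (simp add: field_simps)
  then have "(m powr p) powr (1 / p) \<le> (1 / real n) powr (1 / p)"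
    using p by (intro powr_mono2) auto
  moreover have "(m powr p) powr (1 / p) = m" using m p by (simp add: powr_powr)
  moreover have "(1 / real n) powr (1 / p) = real n powr (- (1 / p))"
    using n by (simp add: powr_divide powr_minus_divide)
  ultimately show ?thesis by (simp only: m_def)
qed simp

text \<open>Reduction to the case of mean weight 1: \<open>|x|\<close> is divided by its mean, and
  homogeneity of degree \<open>r\<close> returns the \<open>r\<close>-th power of that mean, which
  \<open>mean_le_powr\<close> bounds.\<close>

lemma crossing_le_spectral_bound:
  fixes x :: "'a \<Rightarrow> real" and c :: "'a \<Rightarrow> 'i"
  assumes fin: "finite V" and n: "card V = n" and r: "4 \<le> r" and k: "card (c ` V) \<le> k"
    and nr: "(r - 1) * k < n" and p: "1 \<le> p" and x: "x \<in> p_sphere p V"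
  shows "crossing r V c x \<le> chromatic_bound r k n * real n powr (- (real r / p))"
proof -
  define k' where "k' = card (c ` V)"
  define z where "z = (\<lambda>v. \<bar>x v\<bar>)"
  have r': "Suc (r - 1) = r" "1 \<le> r - 1" using r by auto
  have n1: "1 \<le> n" using nr by simp
  have V0: "V \<noteq> {}" using n n1 by auto
  have k1: "1 \<le> k'" using fin V0 by (simp add: k'_def Suc_le_eq card_gt_0_iff)
  then have kk: "1 \<le> k" "k' \<le> k" using k by (auto simp: k'_def)
  have zp: "(\<Sum>v\<in>V. z v powr p) = 1" using x by (simp add: p_sphere_def z_def)
  have bnd0: "0 \<le> chromatic_bound r k n"
    using chromatic_bound_nonneg[OF r'(2) kk(1) nr] unfolding r'(1) .
  have Z: "0 < sum z V"
  proof -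
    have "\<exists>v\<in>V. x v \<noteq> 0"
    proof (rule ccontr)
      assume "\<not> ?thesis"
      then have "(\<Sum>v\<in>V. z v powr p) = 0" by (intro sum.neutral) (auto simp: z_def)
      then show False using zp by simp
    qed
    then show ?thesis using fin by (auto simp: z_def intro!: sum_pos2)
  qed
  define m where "m = sum z V / real n"
  have m: "0 < m" using Z n1 by (simp add: m_def)
  have sumy: "(\<Sum>v\<in>V. inverse m * z v) = real n"
  proof -
    have "(\<Sum>v\<in>V. inverse m * z v) = inverse m * sum z V" by (simp add: sum_distrib_left)
    then show ?thesis using Z n1 by (simp add: m_def)
  qed
  have y: "crossing r V c (\<lambda>v. inverse m * z v) \<le> chromatic_bound r k n"
  proof (cases "k' = 1")
    \<comment> \<open>With a single colour there are no crossing sets; the main estimate needs two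
      classes.\<close>
    case True
    then obtain i where "c ` V = {i}" by (auto simp: k'_def card_1_singleton_iff)
    then have "crossing_sets r V c = {}" by (auto simp: crossing_sets_def colour_class_def)
    then show ?thesis using bnd0 by (simp add: crossing_def)
  next
    case False
    have nr': "(r - 1) * k' < n" using nr kk(2) by (meson le_less_trans mult_le_mono2)
    have "crossing r V c (\<lambda>v. inverse m * z v) \<le> chromatic_bound r k' n"
      using False k1 m sumy
      by (intro crossing_le_chromatic_bound[OF fin n r _ _ nr']) (auto simp: k'_def z_def)
    also have "\<dots> \<le> chromatic_bound r k n"
      using chromatic_bound_mono[OF r'(2) k1 kk(2) nr] unfolding r'(1) .
    finally show ?thesis .
  qed
  have "(\<lambda>v. m * (inverse m * z v)) = z" using m by auto
  then have "crossing r V c z = m ^ r * crossing r V c (\<lambda>v. inverse m * z v)"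
    using crossing_scale[of r V c m "\<lambda>v. inverse m * z v"] by simp
  also have "\<dots> \<le> m ^ r * chromatic_bound r k n" using y m by (intro mult_left_mono) auto
  also have "\<dots> \<le> (real n powr (- (1 / p))) ^ r * chromatic_bound r k n"
    unfolding m_def using bnd0 Z
    by (intro mult_right_mono power_mono mean_le_powr[OF fin n n1 p _ zp]) (auto simp: z_def)
  also have "(real n powr (- (1 / p))) ^ r = real n powr (- (real r / p))"
    using n1 by (simp add: powr_power)
  finally show ?thesis
    using crossing_abs[of r V c x] by (simp add: z_def mult.commute)
qed

section \<open>From partitions into classes to colourings\<close>

lemma k_chromatic_imp_crossing:
  assumes G: "r_graph r V E" and r: "1 \<le> r" and "k_chromatic k V E"
  obtains c :: "'a \<Rightarrow> nat" where "E \<subseteq> crossing_sets r V c" "card (c ` V) \<le> k"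
proof -
  obtain W where W: "(\<Union>i<k. W i) = V" "\<And>e i. e \<in> E \<Longrightarrow> i < k \<Longrightarrow> \<not> e \<subseteq> W i"
    using \<open>k_chromatic k V E\<close> by (auto simp: k_chromatic_def)
  have "\<forall>v\<in>V. \<exists>i<k. v \<in> W i" using W(1) by blast
  then obtain c where c: "\<And>v. v \<in> V \<Longrightarrow> c v < k \<and> v \<in> W (c v)" by metis
  have "E \<subseteq> crossing_sets r V c"
  proof
    fix e assume e: "e \<in> E"
    have "\<not> e \<subseteq> colour_class V c i" for i
    proof
      assume sub: "e \<subseteq> colour_class V c i"
      have "e \<noteq> {}" using G e r by (auto simp: r_graph_def)
      then have "i < k" using sub c by (auto simp: colour_class_def)
      moreover have "e \<subseteq> W i" using sub c by (auto simp: colour_class_def)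
      ultimately show False using W(2) e by blast
    qed
    then show "e \<in> crossing_sets r V c" using G e by (simp add: r_graph_def crossing_sets_def)
  qed
  moreover have "card (c ` V) \<le> card {..<k}" using c by (intro card_mono) auto
  ultimately show thesis using that by simp
qed

text \<open>The partition is padded with empty classes, which could contain only an empty
  edge.\<close>

lemma k_chromatic_mono:
  assumes "k_chromatic k V E" "k \<le> l" "{} \<notin> E"
  shows "k_chromatic l V E"
proof -
  obtain W where W: "(\<Union>i<k. W i) = V" "disjoint_family_on W {..<k}" "\<forall>e\<in>E. \<forall>i<k. \<not> e \<subseteq> W i"
    using assms by (auto simp: k_chromatic_def)
  let ?W = "\<lambda>i. if i < k then W i else {}"
  have "(\<Union>i<l. ?W i) = V" using W(1) assms(2) by (fastforce split: if_splits)
  moreover have "disjoint_family_on ?W {..<l}" using W(2) by (auto simp: disjoint_family_on_def)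
  moreover have "\<forall>e\<in>E. \<forall>i<l. \<not> e \<subseteq> ?W i" using W(3) assms(3) by auto
  ultimately show ?thesis unfolding k_chromatic_def by blast
qed

text \<open>Singleton classes contain no edge of size at least 2. This guarantees that the minimum
  in \<open>chromatic_number\<close> is attained.\<close>

lemma k_chromatic_card:
  assumes "r_graph r V E" "2 \<le> r"
  shows "k_chromatic (card V) V E"
proof -
  have "finite V" using assms by (simp add: r_graph_def)
  then obtain f where f: "bij_betw f {..<card V} V"
    using ex_bij_betw_nat_finite[of V] by (auto simp: atLeast0LessThan)
  have "\<not> e \<subseteq> {f i}" if "e \<in> E" for e i
    using card_mono[of "{f i}" e] assms that by (auto simp: r_graph_def)
  moreover have "(\<Union>i<card V. {f i}) = V" using f by (auto simp: bij_betw_def)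
  moreover have "disjoint_family_on (\<lambda>i. {f i}) {..<card V}"
    using f by (auto simp: disjoint_family_on_def bij_betw_def inj_on_def)
  ultimately show ?thesis unfolding k_chromatic_def by (intro exI[of _ "\<lambda>i. {f i}"]) auto
qed

theorem corollary1p5:
  fixes r k n :: nat and p :: real and V :: "'a set" and E :: "'a set set"
  assumes "r \<ge> 4" and "k \<ge> 2" and "p \<ge> 1" and "n > (r - 1) * k"
    and "r_graph r V E" and "card V = n"
    and "spectral_radius p r V E >
           fact r * (real (n choose r) - real k * ((real n / real k) gchoose r))
             * real n powr (- (real r / p))"
  shows "\<not> k_chromatic k V E \<and> chromatic_number V E \<ge> k + 1"
proof -
  have fin: "finite V" using assms by (simp add: r_graph_def)
  have V0: "V \<noteq> {}" using assms by auto
  have not: "\<not> k_chromatic k V E"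
  proof
    assume "k_chromatic k V E"
    then obtain c :: "'a \<Rightarrow> nat" where c: "E \<subseteq> crossing_sets r V c" "card (c ` V) \<le> k"
      using k_chromatic_imp_crossing[OF assms(5)] assms(1) by (metis le_trans one_le_numeral)
    obtain x where x: "x \<in> p_sphere p V" "poly_form r E x = spectral_radius p r V E"
      using spectral_radius_is_max[OF assms(5) V0 assms(3)] by blast
    \<comment> \<open>Absolute values make all terms nonnegative, so \<open>E\<close> can be
      enlarged to the set of all crossing sets.\<close>
    have "(\<Sum>e\<in>E. \<Prod>v\<in>e. x v) \<le> (\<Sum>e\<in>E. \<Prod>v\<in>e. \<bar>x v\<bar>)"
      by (intro sum_mono) (simp flip: abs_prod)
    also have "\<dots> \<le> crossing r V c (\<lambda>v. \<bar>x v\<bar>)"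
      unfolding crossing_def using c(1) fin
      by (intro sum_mono2) (auto simp: finite_crossing_sets intro!: prod_nonneg)
    also have "\<dots> \<le> chromatic_bound r k n * real n powr (- (real r / p))"
      using x(1) by (intro crossing_le_spectral_bound fin assms c) (simp add: p_sphere_def)
    finally have "poly_form r E x \<le> fact r * (chromatic_bound r k n * real n powr (- (real r / p)))"
      unfolding poly_form_def by (intro mult_left_mono) auto
    then show False using assms(7) x(2) by (simp add: chromatic_bound_def mult.assoc)
  qed
  have "k_chromatic (chromatic_number V E) V E"
    unfolding chromatic_number_def
    by (rule LeastI[of _ "card V"], rule k_chromatic_card[OF assms(5)]) (use assms(1) in simp)
  moreover have "{} \<notin> E" using assms(1,5) by (auto simp: r_graph_def)
  ultimately have "\<not> chromatic_number V E \<le> k" using not k_chromatic_mono by blast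
  then show ?thesis using not by simp
qed

end
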